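(* Let $f:\mathcal{M}\to\mathbb{R}$ be a smooth function. Let $\nabla^f$ denote the Levi-Civita connection of the metric $e^{2f}g_E$ on $\mathcal{M}$, and suppose that $\nabla^f X=0$, where $X$ denotes the tautological vector field $X|_g=g$ on $\mathcal{M}$. Then $f(g)=-\tfrac12\log V_g+C$ for all $g\in\mathcal{M}$, for some constant $C\in\mathbb{R}$.
   Context: $M$ is an $n$-dimensional compact closed manifold and $\mathcal{M}$ is the space of all smooth Riemannian metrics on $M$, an open cone in the Fréchet space $\Gamma(S^2T^*M)$ of smooth symmetric $(0,2)$-tensor fields; so $T_g\mathcal{M}\cong\Gamma(S^2T^*M)$. The Ebin metric is the (weak) Riemannian metric on $\mathcal{M}$ given by $g_E(h,k)|_g=\int_M \mathrm{tr}(g^{-1}hg^{-1}k)\,dV_g$ for $g\in\mathcal{M}$ and $h,k\in T_g\mathcal{M}$, where $g^{-1}h$ is the $(1,1)$-tensor dual to $h$ with respect to $g$. $V_g=\int_M dV_g$ is the total volume of $(M,g)$. The metric $e^{2f}g_E$ is $e^{2f(g)}g_E(h,k)|_g$ at $g$. A Levi-Civita connection of a weak Riemannian metric is a torsion-free connection compatible with that metric. *)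

theory Defs
  imports "HOL-Analysis.Analysis" "HOL-Library.Function_Algebras"
begin

instantiation "fun" :: (type, real_vector) real_vector
begin

definition scaleR_fun :: "real \<Rightarrow> ('a \<Rightarrow> 'b) \<Rightarrow> 'a \<Rightarrow> 'b"
  where "scaleR_fun a f = (\<lambda>x. a *\<^sub>R f x)"

instance
  by standard (auto simp: scaleR_fun_def fun_eq_iff scaleR_add_right scaleR_add_left)

end

text \<open>Iterated directional derivatives; the head of the list is the direction of the
  last differentiation.\<close>

primrec iter_deriv :: "'a::real_normed_vector list \<Rightarrow> ('a \<Rightarrow> 'b::real_normed_vector) \<Rightarrow> 'a \<Rightarrow> 'b"
  where
    "iter_deriv [] f = f"
  | "iter_deriv (v # vs) f = (\<lambda>x. frechet_derivative (iter_deriv vs f) (at x) v)"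

text \<open>Intended for open \<open>S\<close>: all iterated directional derivatives exist and are
  differentiable (hence continuous), so \<open>f\<close> is of class \<open>C\<close>-infinity.\<close>

definition smooth_on :: "'a::real_normed_vector set \<Rightarrow> ('a \<Rightarrow> 'b::real_normed_vector) \<Rightarrow> bool"
  where "smooth_on S f \<longleftrightarrow> (\<forall>vs. \<forall>x\<in>S. iter_deriv vs f differentiable (at x))"

text \<open>The manifold is the whole type \<open>'m\<close>; its dimension is \<open>CARD('n)\<close>.
  A chart is a pair of its domain and its coordinate map. Charts take values in open subsets
  of Euclidean space, so the manifold has no boundary.\<close>

type_synonym ('m, 'n) chart = "'m set \<times> ('m \<Rightarrow> real^'n)"

abbreviation chart_dom :: "('m, 'n) chart \<Rightarrow> 'm set"
  where "chart_dom c \<equiv> fst c"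

abbreviation chart_map :: "('m, 'n) chart \<Rightarrow> 'm \<Rightarrow> real^'n"
  where "chart_map c \<equiv> snd c"

abbreviation chart_inv :: "('m, 'n) chart \<Rightarrow> real^'n \<Rightarrow> 'm"
  where "chart_inv c \<equiv> inv_into (fst c) (snd c)"

definition transition :: "('m, 'n::finite) chart \<Rightarrow> ('m, 'n) chart \<Rightarrow> real^'n \<Rightarrow> real^'n"
  where "transition c d = chart_map d \<circ> chart_inv c"

definition smooth_atlas :: "('m::topological_space, 'n::finite) chart set \<Rightarrow> bool"
  where "smooth_atlas A \<longleftrightarrow>
    (\<forall>c\<in>A. open (chart_dom c) \<and> open (chart_map c ` chart_dom c) \<and>
       homeomorphism (chart_dom c) (chart_map c ` chart_dom c) (chart_map c) (chart_inv c)) \<and>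
    (\<Union>c\<in>A. chart_dom c) = UNIV \<and>
    (\<forall>c\<in>A. \<forall>d\<in>A. smooth_on (chart_map c ` (chart_dom c \<inter> chart_dom d)) (transition c d))"

definition chart_at :: "('m, 'n) chart set \<Rightarrow> 'm \<Rightarrow> ('m, 'n) chart"
  where "chart_at A p = (SOME c. c \<in> A \<and> p \<in> chart_dom c)"

text \<open>A tensor field \<open>h\<close> is given by its component matrices: \<open>h c p $ i $ j\<close> is the value of
  \<open>h\<close> at \<open>p\<close> on the \<open>i\<close>-th and \<open>j\<close>-th coordinate vector fields of the chart \<open>c\<close>.\<close>

type_synonym ('m, 'n) tensor2 = "('m, 'n) chart \<Rightarrow> 'm \<Rightarrow> real^'n^'n"

definition transition_jacobian :: "('m, 'n::finite) chart \<Rightarrow> ('m, 'n) chart \<Rightarrow> 'm \<Rightarrow> real^'n^'n"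
  where "transition_jacobian c d p =
    matrix (frechet_derivative (transition c d) (at (chart_map c p)))"

text \<open>The last clause normalises the meaningless components to zero, so that equality of
  tensor fields is equality of functions.\<close>

definition sym_tensors :: "('m, 'n::finite) chart set \<Rightarrow> ('m, 'n) tensor2 set"
  where "sym_tensors A = {h.
    (\<forall>c\<in>A. \<forall>p\<in>chart_dom c. transpose (h c p) = h c p) \<and>
    (\<forall>c\<in>A. \<forall>d\<in>A. \<forall>p\<in>chart_dom c \<inter> chart_dom d.
       h c p = transpose (transition_jacobian c d p) ** h d p ** transition_jacobian c d p) \<and>
    (\<forall>c\<in>A. smooth_on (chart_map c ` chart_dom c) (\<lambda>x. h c (chart_inv c x))) \<and>
    (\<forall>c p. c \<notin> A \<or> p \<notin> chart_dom c \<longrightarrow> h c p = 0)}"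

definition riem_metrics :: "('m, 'n::finite) chart set \<Rightarrow> ('m, 'n) tensor2 set"
  where "riem_metrics A = {g \<in> sym_tensors A.
    \<forall>c\<in>A. \<forall>p\<in>chart_dom c. \<forall>v. v \<noteq> 0 \<longrightarrow> 0 < v \<bullet> (g c p *v v)}"

text \<open>The Frechet topology: uniform convergence of all iterated derivatives of the components
  on compact subsets of chart images. Finite intersections of the sets below are the
  neighbourhoods defined by the corresponding seminorms.\<close>

definition tensor_ball ::
    "('m, 'n::finite) chart set \<Rightarrow> ('m, 'n) chart \<Rightarrow> (real^'n) set \<Rightarrow> (real^'n) list \<Rightarrow>
     real \<Rightarrow> ('m, 'n) tensor2 \<Rightarrow> ('m, 'n) tensor2 set"
  where "tensor_ball A c K vs e h = {k \<in> sym_tensors A.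
    \<forall>x\<in>K. norm (iter_deriv vs (\<lambda>y. (k - h) c (chart_inv c y)) x) < e}"

definition tensor_topology :: "('m, 'n::finite) chart set \<Rightarrow> ('m, 'n) tensor2 topology"
  where "tensor_topology A = topology_generated_by
    {tensor_ball A c K vs e h | c K vs e h.
       c \<in> A \<and> compact K \<and> K \<subseteq> chart_map c ` chart_dom c \<and> 0 < e \<and> h \<in> sym_tensors A}"

text \<open>\<open>T\<close> is the topology of the target: the real line or the space of tensor fields. Both are
  Hausdorff, so the limit is unique if it exists.\<close>

definition diff_quot :: "('a::real_vector \<Rightarrow> 'v::real_vector) \<Rightarrow> 'a \<Rightarrow> 'a \<Rightarrow> real \<Rightarrow> 'v"
  where "diff_quot F g h t = (1 / t) *\<^sub>R (F (g + t *\<^sub>R h) - F g)"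

definition dir_deriv :: "'v topology \<Rightarrow> ('a::real_vector \<Rightarrow> 'v::real_vector) \<Rightarrow> 'a \<Rightarrow> 'a \<Rightarrow> 'v"
  where "dir_deriv T F g h = (THE l. limitin T (diff_quot F g h) l (at 0))"

text \<open>\<open>nth_deriv T F k g H\<close> is the \<open>k\<close>-th derivative of \<open>F\<close> at \<open>g\<close> in the directions
  \<open>H 0, \<dots>, H (k - 1)\<close>.\<close>

primrec nth_deriv ::
    "'v topology \<Rightarrow> ('a::real_vector \<Rightarrow> 'v::real_vector) \<Rightarrow> nat \<Rightarrow> 'a \<Rightarrow> (nat \<Rightarrow> 'a) \<Rightarrow> 'v"
  where
    "nth_deriv T F 0 = (\<lambda>g H. F g)"
  | "nth_deriv T F (Suc k) = (\<lambda>g H. dir_deriv T (\<lambda>g'. nth_deriv T F k g' H) g (H k))"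

text \<open>Smoothness in the sense of Michal, Bastiani and Hamilton: all iterated directional
  derivatives exist, and the \<open>k\<close>-th one is jointly continuous in the base point and its \<open>k\<close>
  directions. Values of \<open>F\<close> outside of the set of Riemannian metrics are irrelevant.\<close>

definition frechet_smooth ::
    "('m, 'n::finite) chart set \<Rightarrow> 'v topology \<Rightarrow> (('m, 'n) tensor2 \<Rightarrow> 'v::real_vector) \<Rightarrow> bool"
  where "frechet_smooth A T F \<longleftrightarrow> (\<forall>k.
    (\<forall>g\<in>riem_metrics A. \<forall>H. (\<forall>i\<le>k. H i \<in> sym_tensors A) \<longrightarrow>
       (\<exists>l. limitin T (diff_quot (\<lambda>g'. nth_deriv T F k g' H) g (H k)) l (at 0))) \<and>
    continuous_map
      (prod_topology (subtopology (tensor_topology A) (riem_metrics A))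
         (product_topology (\<lambda>_. tensor_topology A) {..<k}))
      T (\<lambda>(g, H). nth_deriv T F k g H))"

text \<open>Vector fields on the space of metrics are normalised to vanish outside of it.\<close>

definition vector_fields ::
    "('m, 'n::finite) chart set \<Rightarrow> (('m, 'n) tensor2 \<Rightarrow> ('m, 'n) tensor2) set"
  where "vector_fields A = {Y. frechet_smooth A (tensor_topology A) Y \<and>
    (\<forall>g. g \<notin> riem_metrics A \<longrightarrow> Y g = 0)}"

definition tautological_field ::
    "('m, 'n::finite) chart set \<Rightarrow> ('m, 'n) tensor2 \<Rightarrow> ('m, 'n) tensor2"
  where "tautological_field A = (\<lambda>g. if g \<in> riem_metrics A then g else 0)"

definition lie_bracket ::
    "('m, 'n::finite) chart set \<Rightarrow> (('m, 'n) tensor2 \<Rightarrow> ('m, 'n) tensor2) \<Rightarrow>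
     (('m, 'n) tensor2 \<Rightarrow> ('m, 'n) tensor2) \<Rightarrow> ('m, 'n) tensor2 \<Rightarrow> ('m, 'n) tensor2"
  where "lie_bracket A Y Z g =
    dir_deriv (tensor_topology A) Z g (Y g) - dir_deriv (tensor_topology A) Y g (Z g)"

text \<open>\<open>nabla Y Z\<close> is the covariant derivative of \<open>Z\<close> along \<open>Y\<close>.\<close>

definition connection ::
    "('m, 'n::finite) chart set \<Rightarrow>
     ((('m, 'n) tensor2 \<Rightarrow> ('m, 'n) tensor2) \<Rightarrow> (('m, 'n) tensor2 \<Rightarrow> ('m, 'n) tensor2) \<Rightarrow>
       ('m, 'n) tensor2 \<Rightarrow> ('m, 'n) tensor2) \<Rightarrow> bool"
  where "connection A nabla \<longleftrightarrow>
    (\<forall>Y\<in>vector_fields A. \<forall>Z\<in>vector_fields A. nabla Y Z \<in> vector_fields A) \<and>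
    (\<forall>Y\<in>vector_fields A. \<forall>Y'\<in>vector_fields A. \<forall>Z\<in>vector_fields A. \<forall>g\<in>riem_metrics A.
       nabla (Y + Y') Z g = nabla Y Z g + nabla Y' Z g) \<and>
    (\<forall>u Y Z. frechet_smooth A euclideanreal u \<and> Y \<in> vector_fields A \<and> Z \<in> vector_fields A \<longrightarrow>
       (\<forall>g\<in>riem_metrics A. nabla (\<lambda>g'. u g' *\<^sub>R Y g') Z g = u g *\<^sub>R nabla Y Z g)) \<and>
    (\<forall>Y\<in>vector_fields A. \<forall>Z\<in>vector_fields A. \<forall>Z'\<in>vector_fields A. \<forall>g\<in>riem_metrics A.
       nabla Y (Z + Z') g = nabla Y Z g + nabla Y Z' g) \<and>
    (\<forall>u Y Z. frechet_smooth A euclideanreal u \<and> Y \<in> vector_fields A \<and> Z \<in> vector_fields A \<longrightarrow>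
       (\<forall>g\<in>riem_metrics A. nabla Y (\<lambda>g'. u g' *\<^sub>R Z g') g =
          u g *\<^sub>R nabla Y Z g + dir_deriv euclideanreal u g (Y g) *\<^sub>R Z g))"

definition torsion_free ::
    "('m, 'n::finite) chart set \<Rightarrow>
     ((('m, 'n) tensor2 \<Rightarrow> ('m, 'n) tensor2) \<Rightarrow> (('m, 'n) tensor2 \<Rightarrow> ('m, 'n) tensor2) \<Rightarrow>
       ('m, 'n) tensor2 \<Rightarrow> ('m, 'n) tensor2) \<Rightarrow> bool"
  where "torsion_free A nabla \<longleftrightarrow>
    (\<forall>Y\<in>vector_fields A. \<forall>Z\<in>vector_fields A. \<forall>g\<in>riem_metrics A.
       nabla Y Z g - nabla Z Y g = lie_bracket A Y Z g)"

definition metric_compatible ::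
    "('m, 'n::finite) chart set \<Rightarrow>
     (('m, 'n) tensor2 \<Rightarrow> ('m, 'n) tensor2 \<Rightarrow> ('m, 'n) tensor2 \<Rightarrow> real) \<Rightarrow>
     ((('m, 'n) tensor2 \<Rightarrow> ('m, 'n) tensor2) \<Rightarrow> (('m, 'n) tensor2 \<Rightarrow> ('m, 'n) tensor2) \<Rightarrow>
       ('m, 'n) tensor2 \<Rightarrow> ('m, 'n) tensor2) \<Rightarrow> bool"
  where "metric_compatible A G nabla \<longleftrightarrow>
    (\<forall>Y\<in>vector_fields A. \<forall>Z\<in>vector_fields A. \<forall>W\<in>vector_fields A. \<forall>g\<in>riem_metrics A.
       dir_deriv euclideanreal (\<lambda>g'. G g' (Z g') (W g')) g (Y g) =
         G g (nabla Y Z g) (W g) + G g (Z g) (nabla Y W g))"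

definition levi_civita ::
    "('m, 'n::finite) chart set \<Rightarrow>
     (('m, 'n) tensor2 \<Rightarrow> ('m, 'n) tensor2 \<Rightarrow> ('m, 'n) tensor2 \<Rightarrow> real) \<Rightarrow>
     ((('m, 'n) tensor2 \<Rightarrow> ('m, 'n) tensor2) \<Rightarrow> (('m, 'n) tensor2 \<Rightarrow> ('m, 'n) tensor2) \<Rightarrow>
       ('m, 'n) tensor2 \<Rightarrow> ('m, 'n) tensor2) \<Rightarrow> bool"
  where "levi_civita A G nabla \<longleftrightarrow>
    connection A nabla \<and> torsion_free A nabla \<and> metric_compatible A G nabla"

text \<open>The unique Borel measure that has density \<open>sqrt (det g)\<close> with respect to Lebesgue measure
  in each chart; no orientation is needed.\<close>

definition riem_volume ::
    "('m::topological_space, 'n::finite) chart set \<Rightarrow> ('m, 'n) tensor2 \<Rightarrow> 'm measure"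
  where "riem_volume A g = (THE \<mu>. sets \<mu> = sets borel \<and>
    (\<forall>c\<in>A. \<forall>B\<in>sets borel. B \<subseteq> chart_dom c \<longrightarrow>
       emeasure \<mu> B =
         (\<integral>\<^sup>+x\<in>chart_map c ` B. ennreal (sqrt (det (g c (chart_inv c x)))) \<partial>lborel)))"

definition total_volume ::
    "('m::topological_space, 'n::finite) chart set \<Rightarrow> ('m, 'n) tensor2 \<Rightarrow> real"
  where "total_volume A g = measure (riem_volume A g) UNIV"

text \<open>The trace does not depend on the chart around \<open>p\<close> in which it is computed.\<close>

definition ebin_metric ::
    "('m::topological_space, 'n::finite) chart set \<Rightarrow>
     ('m, 'n) tensor2 \<Rightarrow> ('m, 'n) tensor2 \<Rightarrow> ('m, 'n) tensor2 \<Rightarrow> real"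
  where "ebin_metric A g h k =
    (\<integral>p. (let c = chart_at A p
           in trace (matrix_inv (g c p) ** h c p ** matrix_inv (g c p) ** k c p))
       \<partial>riem_volume A g)"

definition conformal_ebin_metric ::
    "('m::topological_space, 'n::finite) chart set \<Rightarrow> (('m, 'n) tensor2 \<Rightarrow> real) \<Rightarrow>
     ('m, 'n) tensor2 \<Rightarrow> ('m, 'n) tensor2 \<Rightarrow> ('m, 'n) tensor2 \<Rightarrow> real"
  where "conformal_ebin_metric A f g h k = exp (2 * f g) * ebin_metric A g h k"

end

theory Submission
  imports Defs
begin

text \<open>Apply metric compatibility to the tautological field \<open>X\<close> twice, along a constant field. Since
  \<open>X\<close> is parallel, the function \<open>g \<mapsto> exp (2 f(g)) g\<^sub>E(X, X)\<close> has vanishing directional derivatives,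
  hence is constant along segments, and the cone of metrics is convex. Since \<open>g\<^sup>-\<^sup>1 g\<close> is the identity,
  \<open>g\<^sub>E(X, X)\<close> at \<open>g\<close> is \<open>n\<close> times the total volume, and taking logarithms gives the claim.

  The analytic content is that the total volume has a derivative along lines. It is a finite sum of
  integrals of \<open>sqrt (det g)\<close> over relatively compact Borel pieces of charts, which can be
  differentiated under the integral sign; that the pieces glue to a measure is the change of
  variables formula.\<close>

section \<open>Change of variables\<close>

text \<open>The obstacle is that \<open>dir_deriv\<close> and \<open>riem_volume\<close> are
  definite descriptions. For a parallel X, metric compatibility equates such a description with 0,
  which says nothing about the function until its derivative along lines is known to exist.
  Smoothness of f supplies one factor; the volume factor has to be differentiated by hand. Only
  existence matters there: the value of the derivative comes from compatibility, so no variation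
  formula for the volume is computed. Compatibility speaks of elements of
  \<open>vector_fields\<close> only, which is why X and the constant fields are first shown to be
  smooth in the tensor topology. The factor -1/2 appears on solving 2 f + log V = const for
  f.\<close>

typedef ('a::finite) ordered_copy = "UNIV :: 'a set"
  by simp

instance ordered_copy :: (finite) finite
proof
  have "(UNIV :: 'a ordered_copy set) = range Abs_ordered_copy"
    by (metis (full_types) Abs_ordered_copy_cases surj_def)
  then show "finite (UNIV :: 'a ordered_copy set)"
    by (metis finite finite_imageI)
qed

text \<open>The order is pulled back from the naturals along the injection \<open>to_nat\<close>, so
  well-foundedness is inherited. A fresh type is ordered, so the original index type needs no order
  of its own.\<close>

instantiation ordered_copy :: (finite) wellorder
begin

definition less_eq_ordered_copy :: "'a ordered_copy \<Rightarrow> 'a ordered_copy \<Rightarrow> bool"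
  where "x \<le> y \<longleftrightarrow> to_nat (Rep_ordered_copy x) \<le> to_nat (Rep_ordered_copy y)"

definition less_ordered_copy :: "'a ordered_copy \<Rightarrow> 'a ordered_copy \<Rightarrow> bool"
  where "x < y \<longleftrightarrow> to_nat (Rep_ordered_copy x) < to_nat (Rep_ordered_copy y)"

instance
proof
  fix P :: "'a ordered_copy \<Rightarrow> bool" and a :: "'a ordered_copy"
  assume step: "\<And>x. (\<And>y. y < x \<Longrightarrow> P y) \<Longrightarrow> P x"
  show "P a"
    by (rule measure_induct[of "\<lambda>x. to_nat (Rep_ordered_copy x)" P])
      (use step less_ordered_copy_def in blast)
qed (auto simp: less_eq_ordered_copy_def less_ordered_copy_def Rep_ordered_copy_inject)

end

text \<open>Conjugation with \<open>r\<close> matches the permutations of the two index types and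
  preserves signs, so the two Leibniz sums agree term by term.\<close>

lemma det_reindex:
  fixes B :: "'a::comm_ring_1^'n::finite^'n" and r :: "'k::finite \<Rightarrow> 'n"
  assumes r: "bij r"
  shows "det (\<chi> i j. B $ r i $ r j) = det B"
proof -
  have rr: "r (inv r x) = x" "inv r (r y) = y" for x y
    using r by (simp_all add: bij_is_surj surj_f_inv_f bij_is_inj)
  have eq: "map_permutation UNIV r p = (\<lambda>x. r (p (inv r x)))" for p
    using r by (auto simp: map_permutation_def restrict_id_def bij_is_surj fun_eq_iff)
  have bij: "bij_betw (\<lambda>p. map_permutation UNIV r p) {p. p permutes (UNIV::'k set)} {q. q permutes (UNIV::'n set)}"
    using bij_betw_permutations[of r UNIV UNIV] r by (simp add: eq)
  have "det B = (\<Sum>q | q permutes (UNIV::'n set). of_int (sign q) * (\<Prod>i\<in>UNIV. B $ i $ q i))"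
    by (simp add: det_def)
  also have "\<dots> = (\<Sum>p | p permutes (UNIV::'k set).
      of_int (sign (map_permutation UNIV r p)) * (\<Prod>i\<in>UNIV. B $ i $ (map_permutation UNIV r p) i))"
    by (rule sum.reindex_bij_betw[OF bij, symmetric])
  also have "\<dots> = (\<Sum>p | p permutes (UNIV::'k set). of_int (sign p) * (\<Prod>i\<in>UNIV. B $ r i $ r (p i)))"
  proof (rule sum.cong[OF refl])
    fix p assume "p \<in> {p. p permutes (UNIV::'k set)}"
    then have "sign (map_permutation UNIV r p) = sign p"
      using r by (intro sign_map_permutation) (auto simp: bij_is_inj)
    moreover have "(\<Prod>i\<in>UNIV. B $ i $ (map_permutation UNIV r p) i) = (\<Prod>i\<in>UNIV. B $ r i $ r (p i))"
      using prod.reindex_bij_betw[of r UNIV UNIV "\<lambda>i. B $ i $ r (p (inv r i))"] r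
      by (simp add: eq rr)
    ultimately show "of_int (sign (map_permutation UNIV r p)) * (\<Prod>i\<in>UNIV. B $ i $ (map_permutation UNIV r p) i) =
        of_int (sign p) * (\<Prod>i\<in>UNIV. B $ r i $ r (p i))"
      by simp
  qed
  finally show ?thesis
    by (simp add: det_def)
qed

text \<open>Precomposition with \<open>r\<close>, hence contravariant: a map from \<open>'k\<close>
  to \<open>'n\<close> acts from vectors over \<open>'n\<close> to vectors over
  \<open>'k\<close>.\<close>

definition reindex_vec :: "('k \<Rightarrow> 'n) \<Rightarrow> real^'n::finite \<Rightarrow> real^'k::finite"
  where "reindex_vec r x = (\<chi> i. x $ r i)"

lemma reindex_vec_nth [simp]: "reindex_vec r x $ i = x $ r i"
  by (simp add: reindex_vec_def)

lemma linear_reindex_vec: "linear (reindex_vec r)"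
  by (rule linearI) (auto simp: vec_eq_iff)

lemma bounded_linear_reindex_vec: "bounded_linear (reindex_vec r)"
  by (simp add: linear_reindex_vec linear_linear)

lemma continuous_on_reindex_vec: "continuous_on S (reindex_vec r)"
  by (simp add: linear_reindex_vec linear_continuous_on linear_linear)

lemma borel_measurable_reindex_vec [measurable]: "reindex_vec r \<in> borel_measurable borel"
  by (rule borel_measurable_continuous_onI[OF continuous_on_reindex_vec])

lemma reindex_vec_inv:
  assumes "bij r"
  shows "reindex_vec r (reindex_vec (inv r) y) = y" "reindex_vec (inv r) (reindex_vec r x) = x"
  using assms by (auto simp: vec_eq_iff bij_is_surj surj_f_inv_f bij_is_inj)

section \<open>Lebesgue measure under renumbering of coordinates\<close>

lemma prod_Basis_vec:
  fixes v :: "real^'n::finite"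
  shows "(\<Prod>b\<in>Basis. v \<bullet> b) = (\<Prod>i\<in>UNIV. v $ i)"
proof -
  have B: "(Basis :: (real^'n) set) = (\<lambda>i. axis i 1) ` UNIV"
    by (auto simp: Basis_vec_def)
  have "inj (\<lambda>i::'n. axis i (1::real))"
    by (auto simp: inj_on_def axis_eq_axis)
  then show ?thesis
    unfolding B by (subst prod.reindex) (auto simp: inner_axis)
qed

text \<open>Preimages of boxes are boxes with the same side lengths in another order, and Lebesgue
  measure is determined by its values on boxes.\<close>

lemma distr_lborel_reindex_vec:
  assumes r: "bij (r :: 'k::finite \<Rightarrow> 'n::finite)"
  shows "distr lborel borel (reindex_vec r) = (lborel :: (real^'k) measure)"
proof (rule lborel_eqI[symmetric])
  fix l u :: "real^'k"
  assume lu: "\<And>b. b \<in> Basis \<Longrightarrow> l \<bullet> b \<le> u \<bullet> b"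
  have le: "l $ i \<le> u $ i" for i
    using lu[of "axis i 1"] by (simp add: inner_axis axis_in_Basis_iff)
  have rr: "r (inv r x) = x" "inv r (r y) = y" for x y
    using r by (simp_all add: bij_is_surj surj_f_inv_f bij_is_inj)
  have vim: "reindex_vec r -` box l u = box (reindex_vec (inv r) l) (reindex_vec (inv r) u)"
  proof -
    have "(\<forall>i. P (r i)) \<longleftrightarrow> (\<forall>j. P j)" for P
      by (metis rr(1))
    from this[of "\<lambda>j. l $ inv r j < x $ j \<and> x $ j < u $ inv r j" for x]
    show ?thesis
      by (simp add: set_eq_iff mem_box_cart rr)
  qed
  have "emeasure (distr lborel borel (reindex_vec r)) (box l u) =
      emeasure lborel (box (reindex_vec (inv r) l) (reindex_vec (inv r) u))"
    by (subst emeasure_distr) (auto simp: vim)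
  also have "\<dots> = (\<Prod>b\<in>Basis. (reindex_vec (inv r) u - reindex_vec (inv r) l) \<bullet> b)"
    by (rule emeasure_lborel_box) (auto simp: Basis_vec_def inner_axis le)
  also have "\<dots> = (\<Prod>b\<in>Basis. (u - l) \<bullet> b)"
    unfolding prod_Basis_vec using prod.reindex_bij_betw[of "inv r" UNIV UNIV "\<lambda>i. u $ i - l $ i"] r
    by (simp add: bij_imp_bij_inv)
  finally show "emeasure (distr lborel borel (reindex_vec r)) (box l u) = (\<Prod>b\<in>Basis. (u - l) \<bullet> b)" .
qed simp

lemma nn_integral_lborel_reindex_vec:
  assumes r: "bij (r :: 'k::finite \<Rightarrow> 'n::finite)" and [measurable]: "F \<in> borel_measurable borel"
  shows "(\<integral>\<^sup>+x. F (reindex_vec r x) \<partial>lborel) = (\<integral>\<^sup>+y. F y \<partial>lborel)"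
  by (subst distr_lborel_reindex_vec[OF r, symmetric], subst nn_integral_distr) auto

text \<open>This translates the theorem on absolutely integrable functions into nonnegative
  integrals. Finiteness of the integral provides absolute integrability, and scalar functions are
  viewed as \<open>real^1\<close>-valued by means of \<open>vec\<close>.\<close>

lemma nn_integral_change_of_variables_wellorder:
  fixes \<tau> :: "real^'m::{finite,wellorder} \<Rightarrow> real^'m::_"
  assumes S: "S \<in> sets lebesgue"
    and der: "\<And>x. x \<in> S \<Longrightarrow> (\<tau> has_derivative \<tau>' x) (at x within S)"
    and inj: "inj_on \<tau> S"
    and w0: "\<And>y. y \<in> \<tau> ` S \<Longrightarrow> 0 \<le> w y"
    and wm: "(\<lambda>y. indicator (\<tau> ` S) y * w y) \<in> borel_measurable borel"
    and fin: "(\<integral>\<^sup>+y. ennreal (indicator (\<tau> ` S) y * w y) \<partial>lborel) < \<infinity>"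
  shows "(\<integral>\<^sup>+x. ennreal (indicator S x * (\<bar>det (matrix (\<tau>' x))\<bar> * w (\<tau> x))) \<partial>lborel) =
    (\<integral>\<^sup>+y. ennreal (indicator (\<tau> ` S) y * w y) \<partial>lborel)"
proof -
  define b where "b = enn2real (\<integral>\<^sup>+y. ennreal (indicator (\<tau> ` S) y * w y) \<partial>lborel)"
  have b: "(\<integral>\<^sup>+y. ennreal (indicator (\<tau> ` S) y * w y) \<partial>lborel) = ennreal b" "0 \<le> b"
    using fin by (auto simp: b_def)
  have "((\<lambda>y. indicator (\<tau> ` S) y * w y) has_integral b) UNIV"
    by (rule nn_integral_has_integral[OF wm _ b]) (auto simp: w0 indicator_def)
  then have "((\<lambda>y. if y \<in> \<tau> ` S then w y else 0) has_integral b) UNIV"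
    by (rule has_integral_eq[rotated]) (auto simp: indicator_def)
  then have hi: "(w has_integral b) (\<tau> ` S)"
    by (simp add: has_integral_restrict_UNIV)
  then have ai: "w absolutely_integrable_on (\<tau> ` S)"
    using w0 by (intro nonnegative_absolutely_integrable_1) auto
  have "(\<lambda>x. \<bar>det (matrix (\<tau>' x))\<bar> *\<^sub>R vec (w (\<tau> x)) :: real^1) absolutely_integrable_on S \<and>
      integral S (\<lambda>x. \<bar>det (matrix (\<tau>' x))\<bar> *\<^sub>R vec (w (\<tau> x)) :: real^1) = vec b"
    using has_absolute_integral_change_of_variables[OF S der inj, of "\<lambda>y. vec (w y) :: real^1" "vec b"] hi ai
    by (auto simp: absolutely_integrable_on_1_iff integral_on_1_eq has_integral_iff)
  then have "((\<lambda>x. \<bar>det (matrix (\<tau>' x))\<bar> * w (\<tau> x)) has_integral b) S"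
    by (auto simp: absolutely_integrable_on_1_iff integral_on_1_eq has_integral_iff set_lebesgue_integral_eq_integral(1))
  then show ?thesis
    using nn_integral_has_integral_lebesgue[of S "\<lambda>x. \<bar>det (matrix (\<tau>' x))\<bar> * w (\<tau> x)" b] w0 b by simp
qed

text \<open>The library states the change of variables for well-ordered index types only; conjugating
  with a renumbering of the coordinates removes this restriction.\<close>

lemma nn_integral_change_of_variables:
  fixes \<tau> :: "real^'n::finite \<Rightarrow> real^'n"
  assumes S: "S \<in> sets borel"
    and der: "\<And>x. x \<in> S \<Longrightarrow> (\<tau> has_derivative \<tau>' x) (at x)"
    and inj: "inj_on \<tau> S"
    and w0: "\<And>y. y \<in> \<tau> ` S \<Longrightarrow> 0 \<le> w y"
    and wm: "(\<lambda>y. indicator (\<tau> ` S) y * w y) \<in> borel_measurable borel"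
    and um: "(\<lambda>x. indicator S x * (\<bar>det (matrix (\<tau>' x))\<bar> * w (\<tau> x))) \<in> borel_measurable borel"
    and fin: "(\<integral>\<^sup>+y. ennreal (indicator (\<tau> ` S) y * w y) \<partial>lborel) < \<infinity>"
  shows "(\<integral>\<^sup>+x. ennreal (indicator S x * (\<bar>det (matrix (\<tau>' x))\<bar> * w (\<tau> x))) \<partial>lborel) =
    (\<integral>\<^sup>+y. ennreal (indicator (\<tau> ` S) y * w y) \<partial>lborel)"
proof -
  let ?r = "Rep_ordered_copy :: 'n ordered_copy \<Rightarrow> 'n"
  let ?L = "reindex_vec ?r" and ?M = "reindex_vec (inv ?r)"
  have r: "bij ?r"
    by (metis Abs_ordered_copy_inverse Rep_ordered_copy_inverse UNIV_I bijI')
  have r': "bij (inv ?r)"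
    using r by (rule bij_imp_bij_inv)
  note LM = reindex_vec_inv[OF r]
  \<comment> \<open>\<sigma> is \<tau> conjugated by the linear bijection \<open>?L\<close> with
    inverse \<open>?M\<close>; \<sigma>' is its derivative by the chain rule.\<close>
  define \<sigma> where "\<sigma> = (\<lambda>y. ?L (\<tau> (?M y)))"
  define \<sigma>' where "\<sigma>' = (\<lambda>y v. ?L (\<tau>' (?M y) (?M v)))"
  have im: "\<sigma> ` (?L ` S) = ?L ` \<tau> ` S"
    by (simp add: image_image \<sigma>_def LM)
  have memL: "y \<in> ?L ` T \<longleftrightarrow> ?M y \<in> T" for y T
    using LM(1)[of y] LM(2) by (auto simp: image_iff) (metis LM(1))
  have ind: "indicator (?L ` T) y = (indicator T (?M y) :: real)" for y T
    by (auto simp: indicator_def memL)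
  have LS: "?L ` S \<in> sets borel"
  proof -
    have "?L ` S = ?M -` S \<inter> space borel"
      using memL by auto
    then show ?thesis
      using measurable_sets[OF borel_measurable_reindex_vec S] by metis
  qed
  have der': "(\<sigma> has_derivative \<sigma>' y) (at y within ?L ` S)" if "y \<in> ?L ` S" for y
  proof -
    have "(\<tau> has_derivative \<tau>' (?M y)) (at (?M y))"
      using der that memL by blast
    then have "(\<sigma> has_derivative \<sigma>' y) (at y)"
      unfolding \<sigma>_def \<sigma>'_def
      by (intro bounded_linear.has_derivative[OF bounded_linear_reindex_vec]
          has_derivative_compose[OF bounded_linear_imp_has_derivative[OF bounded_linear_reindex_vec]])
    then show ?thesis
      by (rule has_derivative_at_withinI)
  qed
  \<comment> \<open>Rows and columns of the Jacobian are renumbered alike, so its determinant is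
    unchanged.\<close>
  have det: "det (matrix (\<sigma>' y)) = det (matrix (\<tau>' (?M y)))" for y
  proof -
    have ax: "?M (axis j 1) = axis (?r j) 1" for j
      using r by (auto simp: vec_eq_iff axis_def bij_is_surj surj_f_inv_f bij_is_inj)
    have "matrix (\<sigma>' y) = (\<chi> i j. matrix (\<tau>' (?M y)) $ ?r i $ ?r j)"
      by (auto simp: matrix_def \<sigma>'_def vec_eq_iff ax)
    then show ?thesis
      by (simp add: det_reindex[OF r])
  qed
  have inj': "inj_on \<sigma> (?L ` S)"
  proof (rule inj_onI)
    fix y z assume y: "y \<in> ?L ` S" and z: "z \<in> ?L ` S" and "\<sigma> y = \<sigma> z"
    then have "\<tau> (?M y) = \<tau> (?M z)"
      unfolding \<sigma>_def by (metis LM(2))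
    then have "?M y = ?M z"
      using inj_onD[OF inj] y z memL by blast
    then show "y = z"
      by (metis LM(1))
  qed
  have key: "(\<integral>\<^sup>+y. ennreal (indicator (\<sigma> ` ?L ` S) y * w (?M y)) \<partial>lborel) =
      (\<integral>\<^sup>+y. ennreal (indicator (\<tau> ` S) y * w y) \<partial>lborel)"
    unfolding im ind
    using nn_integral_lborel_reindex_vec[OF r', of "\<lambda>y. ennreal (indicator (\<tau> ` S) y * w y)"] wm by simp
  have "(\<integral>\<^sup>+x. ennreal (indicator S x * (\<bar>det (matrix (\<tau>' x))\<bar> * w (\<tau> x))) \<partial>lborel) =
     (\<integral>\<^sup>+y. ennreal (indicator S (?M y) * (\<bar>det (matrix (\<tau>' (?M y)))\<bar> * w (\<tau> (?M y)))) \<partial>lborel)"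
    using nn_integral_lborel_reindex_vec[OF r',
        of "\<lambda>x. ennreal (indicator S x * (\<bar>det (matrix (\<tau>' x))\<bar> * w (\<tau> x)))"] um by simp
  also have "\<dots> = (\<integral>\<^sup>+y. ennreal (indicator (?L ` S) y * (\<bar>det (matrix (\<sigma>' y))\<bar> * w (?M (\<sigma> y)))) \<partial>lborel)"
    by (simp add: ind det \<sigma>_def LM)
  also have "\<dots> = (\<integral>\<^sup>+y. ennreal (indicator (\<sigma> ` ?L ` S) y * w (?M y)) \<partial>lborel)"
  proof (rule nn_integral_change_of_variables_wellorder[OF _ der' inj'])
    show "?L ` S \<in> sets lebesgue"
      using LS by simp
    show "0 \<le> w (?M y)" if "y \<in> \<sigma> ` ?L ` S" for y
      using that w0 unfolding im memL by blast
    show "(\<lambda>y. indicator (\<sigma> ` ?L ` S) y * w (?M y)) \<in> borel_measurable borel"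
      unfolding im ind using measurable_compose[OF borel_measurable_reindex_vec wm] by simp
    show "(\<integral>\<^sup>+y. ennreal (indicator (\<sigma> ` ?L ` S) y * w (?M y)) \<partial>lborel) < \<infinity>"
      using fin key by simp
  qed
  finally show ?thesis
    using key by simp
qed

section \<open>Determinants of positive definite matrices\<close>

lemma continuous_on_det [continuous_intros]:
  fixes F :: "'a::topological_space \<Rightarrow> real^'n::finite^'n"
  assumes "continuous_on S F"
  shows "continuous_on S (\<lambda>x. det (F x))"
  unfolding det_def by (intro continuous_intros assms)

text \<open>On the segment from the identity to \<open>G\<close> every matrix is positive definite,
  hence has trivial kernel and nonzero determinant. The determinant is 1 at the start, so by the
  intermediate value theorem it cannot be nonpositive at the end.\<close>

lemma positive_definite_det_pos:
  fixes G :: "real^'n::finite^'n"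
  assumes pos: "\<And>v. v \<noteq> 0 \<Longrightarrow> 0 < v \<bullet> (G *v v)"
  shows "0 < det G"
proof (rule ccontr)
  assume neg: "\<not> 0 < det G"
  define M where "M = (\<lambda>t::real. (1 - t) *\<^sub>R mat 1 + t *\<^sub>R G)"
  have nz: "det (M t) \<noteq> 0" if t: "0 \<le> t" "t \<le> 1" for t
  proof -
    have "v = 0" if "M t *v v = 0" for v
    proof (rule ccontr)
      assume v: "v \<noteq> 0"
      have "v \<bullet> (M t *v v) = (1 - t) * (v \<bullet> v) + t * (v \<bullet> (G *v v))"
        by (simp add: M_def matrix_vector_mult_add_rdistrib scaleR_matrix_vector_assoc[symmetric] inner_add_right)
      moreover have "0 < (1 - t) * (v \<bullet> v) + t * (v \<bullet> (G *v v))"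
        using t pos[OF v] v
        by (cases "t = 1") (auto intro!: add_pos_nonneg mult_pos_pos mult_nonneg_nonneg)
      ultimately show False
        using that by simp
    qed
    then have "\<exists>B. B ** M t = mat 1"
      unfolding matrix_left_invertible_ker by blast
    then show ?thesis
      using invertible_det_nz invertible_left_inverse by blast
  qed
  have "\<exists>t\<ge>0. t \<le> 1 \<and> det (M t) = 0"
    by (rule IVT2') (use neg in \<open>auto simp: M_def intro!: continuous_intros\<close>)
  then show False
    using nz by blast
qed

text \<open>On the compact product of \<open>K\<close> with the unit sphere, the form of
  \<open>G\<close> has a positive minimum \<open>a\<close> and the form of \<open>H\<close> is
  bounded by some \<open>b\<close>. A small multiple of the second cannot cancel the first, and
  homogeneity passes from unit vectors to all nonzero ones.\<close>

lemma positive_definite_perturb: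
  fixes G H :: "'a::topological_space \<Rightarrow> real^'n::finite^'n"
  assumes K: "compact K" and G: "continuous_on K G" and H: "continuous_on K H"
    and pos: "\<And>x v. x \<in> K \<Longrightarrow> v \<noteq> 0 \<Longrightarrow> 0 < v \<bullet> (G x *v v)"
  shows "\<exists>e>0. \<forall>t x v. \<bar>t\<bar> \<le> e \<longrightarrow> x \<in> K \<longrightarrow> v \<noteq> 0 \<longrightarrow> 0 < v \<bullet> ((G x + t *\<^sub>R H x) *v v)"
proof (cases "K = {}")
  case False
  let ?Z = "K \<times> sphere (0 :: real^'n) 1"
  have Z: "compact ?Z" "?Z \<noteq> {}"
    using False by (auto intro: compact_Times K)
  have cont: "continuous_on ?Z (\<lambda>z. snd z \<bullet> (M (fst z) *v snd z))"
    if "continuous_on K M" for M :: "'a \<Rightarrow> real^'n^'n"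
    unfolding inner_vec_def matrix_vector_mult_def
    by (intro continuous_intros continuous_on_compose2[OF that]) (auto intro!: continuous_intros)
  obtain z where z: "z \<in> ?Z" "\<And>y. y \<in> ?Z \<Longrightarrow> snd z \<bullet> (G (fst z) *v snd z) \<le> snd y \<bullet> (G (fst y) *v snd y)"
    using continuous_attains_inf[OF Z cont[OF G]] by blast
  define a where "a = snd z \<bullet> (G (fst z) *v snd z)"
  have "snd z \<noteq> 0"
    using z(1) by auto
  then have a: "0 < a"
    unfolding a_def using z(1) by (intro pos) auto
  obtain y where y: "\<And>x. x \<in> ?Z \<Longrightarrow> \<bar>snd x \<bullet> (H (fst x) *v snd x)\<bar> \<le> \<bar>snd y \<bullet> (H (fst y) *v snd y)\<bar>"
    using continuous_attains_sup[OF Z continuous_on_rabs[OF cont[OF H]]] by blast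
  define b where "b = \<bar>snd y \<bullet> (H (fst y) *v snd y)\<bar>"
  have b: "0 \<le> b"
    by (simp add: b_def)
  show ?thesis
  \<comment> \<open>The summand 1 covers the case \<open>b = 0\<close> and makes
    \<open>a / (b + 1) * b < a\<close> strict.\<close>
  proof (intro exI[of _ "a / (b + 1)"] conjI allI impI)
    show "0 < a / (b + 1)"
      using a b by simp
    fix t x and v :: "real^'n"
    assume t: "\<bar>t\<bar> \<le> a / (b + 1)" and x: "x \<in> K" and v: "v \<noteq> 0"
    define w where "w = v /\<^sub>R norm v"
    have xw: "(x, w) \<in> ?Z"
      using x v by (simp add: w_def)
    have "\<bar>w \<bullet> (H x *v w)\<bar> \<le> b"
      using y[OF xw] by (simp add: b_def)
    then have "\<bar>t * (w \<bullet> (H x *v w))\<bar> \<le> a / (b + 1) * b"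
      unfolding abs_mult using t a b by (intro mult_mono) auto
    also have "\<dots> < a"
      using a b by (simp add: field_simps)
    finally have "0 < w \<bullet> (G x *v w) + t * (w \<bullet> (H x *v w))"
      using z(2)[OF xw] unfolding a_def by simp
    also have "\<dots> = w \<bullet> ((G x + t *\<^sub>R H x) *v w)"
      by (simp add: matrix_vector_mult_add_rdistrib scaleR_matrix_vector_assoc[symmetric] inner_add_right)
    also have "\<dots> = inverse (norm v) * (inverse (norm v) * (v \<bullet> ((G x + t *\<^sub>R H x) *v v)))"
      unfolding w_def matrix_vector_mult_scaleR inner_scaleR_left inner_scaleR_right ..
    finally have "0 < inverse (norm v) * (inverse (norm v) * (v \<bullet> ((G x + t *\<^sub>R H x) *v v)))" .
    moreover have "0 < inverse (norm v)"
      using v by simp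
    ultimately show "0 < v \<bullet> ((G x + t *\<^sub>R H x) *v v)"
      using zero_less_mult_pos by blast
  qed
qed (auto intro: exI[of _ 1])

text \<open>The derivative of \<open>det\<close> at \<open>G\<close> in the direction
  \<open>H\<close>, as the product rule yields it from the Leibniz sum. In this polynomial form
  continuity is immediate and no inverse matrix occurs.\<close>

definition det_deriv :: "real^'n::finite^'n \<Rightarrow> real^'n^'n \<Rightarrow> real"
  where "det_deriv G H = (\<Sum>p | p permutes (UNIV::'n set). of_int (sign p) *
    (\<Sum>i\<in>UNIV. H $ i $ p i * (\<Prod>j\<in>UNIV - {i}. G $ j $ p j)))"

lemma has_field_derivative_det_line:
  "((\<lambda>t. det (G + t *\<^sub>R H)) has_field_derivative det_deriv (G + t *\<^sub>R H) H) (at t)"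
  unfolding det_def det_deriv_def
  by (intro DERIV_sum DERIV_cmult has_field_derivative_prod) (auto intro!: derivative_eq_intros)

lemma continuous_on_det_deriv [continuous_intros]:
  assumes "continuous_on S F" "continuous_on S H"
  shows "continuous_on S (\<lambda>x. det_deriv (F x) (H x))"
  unfolding det_deriv_def by (intro continuous_intros assms)

section \<open>Differentiation under the integral sign\<close>

lemma integrable_indicator_compact:
  fixes f :: "'a::euclidean_space \<Rightarrow> real"
  assumes "compact K" "continuous_on K f" "S \<subseteq> K" "S \<in> sets borel"
  shows "integrable lborel (\<lambda>x. indicator S x * f x)"
proof -
  have "integrable lborel (\<lambda>x. indicator S x *\<^sub>R (indicator K x *\<^sub>R f x))"
    by (rule integrable_mult_indicator) (use assms borel_integrable_compact[OF assms(1,2)] in simp_all)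
  moreover have "(\<lambda>x. indicator S x *\<^sub>R (indicator K x *\<^sub>R f x)) = (\<lambda>x. indicator S x * f x)"
    using assms(3) by (auto simp: indicator_def fun_eq_iff)
  ultimately show ?thesis by simp
qed

text \<open>The t-derivative of the integrand is continuous on the compact set
  \<open>{-e..e} \<times> K\<close>, hence bounded by some \<open>B\<close>. The mean value
  inequality then bounds all difference quotients by \<open>B\<close>, and dominated convergence
  applies. The domain \<open>S\<close> is merely Borel; the compactness comes from
  \<open>K\<close>.\<close>

lemma differentiable_integral_sqrt_det:
  fixes G H :: "'a::euclidean_space \<Rightarrow> real^'n::finite^'n"
  assumes K: "compact K" and S: "S \<subseteq> K" "S \<in> sets borel"
    and G: "continuous_on K G" and H: "continuous_on K H" and e: "0 < e"
    and pos: "\<And>t x. \<bar>t\<bar> \<le> e \<Longrightarrow> x \<in> K \<Longrightarrow> 0 < det (G x + t *\<^sub>R H x)"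
  shows "\<exists>l. ((\<lambda>t. \<integral>x. indicator S x * sqrt (det (G x + t *\<^sub>R H x)) \<partial>lborel)
    has_field_derivative l) (at 0)"
proof -
  define P where "P = (\<lambda>t x. det (G x + t *\<^sub>R H x))"
  \<comment> \<open>\<open>u t x\<close> is the t-derivative of \<open>sqrt (P t x)\<close>.\<close>
  define u where "u = (\<lambda>t x. det_deriv (G x + t *\<^sub>R H x) (H x) * (inverse (sqrt (P t x)) / 2))"
  define F where "F = (\<lambda>t. \<integral>x. indicator S x * sqrt (P t x) \<partial>lborel)"
  have P0: "0 < P t x" if "\<bar>t\<bar> \<le> e" "x \<in> K" for t x
    using pos that by (simp add: P_def)
  have der: "((\<lambda>t. sqrt (P t x)) has_field_derivative u t x) (at t)" if "\<bar>t\<bar> \<le> e" "x \<in> K" for t x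
  proof -
    have "((\<lambda>t. P t x) has_field_derivative det_deriv (G x + t *\<^sub>R H x) (H x)) (at t)"
      unfolding P_def by (rule has_field_derivative_det_line)
    from DERIV_chain2[where g = "\<lambda>t. P t x", OF DERIV_real_sqrt[OF P0[OF that]] this]
    show ?thesis
      by (simp add: u_def mult_ac)
  qed
  have cG: "continuous_on ({-e..e} \<times> K) (\<lambda>z. G (snd z))" "continuous_on ({-e..e} \<times> K) (\<lambda>z. H (snd z))"
    by (auto intro!: continuous_on_compose2[OF G] continuous_on_compose2[OF H] continuous_intros)
  have cP: "continuous_on ({-e..e} \<times> K) (\<lambda>z. P (fst z) (snd z))"
    unfolding P_def by (intro continuous_intros cG)
  have cu: "continuous_on ({-e..e} \<times> K) (\<lambda>z. u (fst z) (snd z))"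
    unfolding u_def
  proof (intro continuous_on_mult continuous_on_divide continuous_on_inverse continuous_on_const ballI)
    show "continuous_on ({-e..e} \<times> K) (\<lambda>z. det_deriv (G (snd z) + fst z *\<^sub>R H (snd z)) (H (snd z)))"
      by (intro continuous_intros cG)
    show "continuous_on ({-e..e} \<times> K) (\<lambda>z. sqrt (P (fst z) (snd z)))"
      by (intro continuous_intros cP)
    show "sqrt (P (fst z) (snd z)) \<noteq> 0" if "z \<in> {-e..e} \<times> K" for z
    proof -
      have "0 < P (fst z) (snd z)"
        using that by (intro P0) (auto simp: mem_Times_iff)
      then show ?thesis
        by simp
    qed
  qed simp
  have "compact ((\<lambda>z. u (fst z) (snd z)) ` ({-e..e} \<times> K))"
    by (intro compact_continuous_image cu compact_Times K compact_Icc)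
  then obtain B where B: "\<And>z. z \<in> {-e..e} \<times> K \<Longrightarrow> \<bar>u (fst z) (snd z)\<bar> \<le> B"
    using compact_imp_bounded bounded_real by (metis (no_types, lifting) imageI)
  have cPx: "continuous_on K (P t)" if "\<bar>t\<bar> \<le> e" for t
    unfolding P_def by (intro continuous_intros G H)
  have int: "integrable lborel (\<lambda>x. indicator S x * sqrt (P t x))" if "\<bar>t\<bar> \<le> e" for t
    by (rule integrable_indicator_compact[OF K _ S]) (intro continuous_intros cPx that)
  have lip: "\<bar>sqrt (P t x) - sqrt (P 0 x)\<bar> \<le> B * \<bar>t\<bar>" if "\<bar>t\<bar> \<le> e" "x \<in> K" for t x
  proof -
    have "norm (sqrt (P t x) - sqrt (P 0 x)) \<le> B * norm (t - 0)"
    proof (rule field_differentiable_bound[where S = "{-e..e}" and f = "\<lambda>s. sqrt (P s x)" and f' = "\<lambda>s. u s x"])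
      fix s assume s: "s \<in> {-e..e}"
      then have "\<bar>s\<bar> \<le> e"
        by auto
      then show "((\<lambda>t. sqrt (P t x)) has_field_derivative u s x) (at s within {-e..e})"
        using der \<open>x \<in> K\<close> has_field_derivative_at_within by blast
      show "norm (u s x) \<le> B"
        using B[of "(s, x)"] s \<open>x \<in> K\<close> by simp
    next
      show "t \<in> {-e..e}" "0 \<in> {-e..e}"
        using that(1) e by auto
    qed simp
    then show ?thesis by simp
  qed
  define q where "q = (\<lambda>t x. indicator S x * ((sqrt (P t x) - sqrt (P 0 x)) / t))"
  \<comment> \<open>Dominated convergence is about sequences, so the limit is tested on sequences
    tending to 0. Restricting to the interval keeps every term where the determinants are positive;
    as the interval is a neighbourhood of 0, the restriction is dropped at the end.\<close>
  have "((\<lambda>t. (F t - F 0) / t) \<longlongrightarrow> (\<integral>x. indicator S x * u 0 x \<partial>lborel)) (at 0 within {-e<..<e})"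
    unfolding tendsto_at_iff_sequentially comp_def
  proof (intro allI impI)
    fix X :: "nat \<Rightarrow> real"
    assume X: "\<forall>i. X i \<in> {-e<..<e} - {0}" and X0: "X \<longlonglongrightarrow> 0"
    have Xe: "\<bar>X i\<bar> \<le> e" "X i \<noteq> 0" for i
      using X[rule_format, of i] by auto
    have qi: "integrable lborel (q (X i))" for i
    proof -
      have "integrable lborel (\<lambda>x. (indicator S x * sqrt (P (X i) x) - indicator S x * sqrt (P 0 x)) / X i)"
        using int Xe e by (intro integrable_divide Bochner_Integration.integrable_diff) auto
      then show ?thesis
        by (simp add: q_def algebra_simps)
    qed
    have eq: "(F (X i) - F 0) / X i = (\<integral>x. q (X i) x \<partial>lborel)" for i
      using Bochner_Integration.integral_diff[OF int[OF Xe(1)[of i]] int[of 0]] e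
      by (simp add: F_def q_def integral_divide_zero[symmetric] right_diff_distrib)
    have "(\<lambda>i. \<integral>x. q (X i) x \<partial>lborel) \<longlonglongrightarrow> (\<integral>x. indicator S x * u 0 x \<partial>lborel)"
    proof (rule integral_dominated_convergence[where w = "\<lambda>x. indicator S x * B"])
      show "q (X i) \<in> borel_measurable lborel" for i
        using qi by auto
      show "integrable lborel (\<lambda>x. indicator S x * B)"
        by (rule integrable_indicator_compact[OF K _ S]) auto
      have "continuous_on K (\<lambda>x. u (fst (0::real, x)) (snd (0::real, x)))"
        by (rule continuous_on_compose2[OF cu, of K "\<lambda>x. (0, x)"]) (use e in \<open>auto intro!: continuous_intros\<close>)
      then have "integrable lborel (\<lambda>x. indicator S x * u 0 x)"
        by (intro integrable_indicator_compact[OF K _ S]) simp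
      then show "(\<lambda>x. indicator S x * u 0 x) \<in> borel_measurable lborel"
        by auto
      have "(\<lambda>i. q (X i) x) \<longlonglongrightarrow> indicator S x * u 0 x" for x
      proof (cases "x \<in> S")
        case True
        then have "((\<lambda>t. (sqrt (P t x) - sqrt (P 0 x)) / (t - 0)) \<longlongrightarrow> u 0 x) (at 0)"
          using der[of 0 x] S e unfolding has_field_derivative_iff by auto
        then have "(\<lambda>i. (sqrt (P (X i) x) - sqrt (P 0 x)) / (X i - 0)) \<longlonglongrightarrow> u 0 x"
          using Xe X0 by (auto simp: tendsto_at_iff_sequentially comp_def)
        then show ?thesis
          using True by (simp add: q_def)
      qed (simp add: q_def)
      then show "AE x in lborel. (\<lambda>i. q (X i) x) \<longlonglongrightarrow> indicator S x * u 0 x"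
        by simp
      have "\<bar>q (X i) x\<bar> \<le> indicator S x * B" for i x
      proof (cases "x \<in> S")
        case True
        then have "\<bar>sqrt (P (X i) x) - sqrt (P 0 x)\<bar> / \<bar>X i\<bar> \<le> B"
          using lip[of "X i" x] S Xe[of i] by (auto simp: divide_le_eq)
        then show ?thesis
          using True by (simp add: q_def)
      qed (simp add: q_def)
      then show "AE x in lborel. norm (q (X i) x) \<le> indicator S x * B" for i
        by simp
    qed
    then show "(\<lambda>i. (F (X i) - F 0) / X i) \<longlonglongrightarrow> (\<integral>x. indicator S x * u 0 x \<partial>lborel)"
      by (simp add: eq)
  qed
  then have "((\<lambda>t. (F t - F 0) / t) \<longlongrightarrow> (\<integral>x. indicator S x * u 0 x \<partial>lborel)) (at 0)"
    using e by (subst (asm) at_within_open) auto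
  then have "(F has_field_derivative (\<integral>x. indicator S x * u 0 x \<partial>lborel)) (at 0)"
    by (simp add: has_field_derivative_iff)
  then show ?thesis
    unfolding F_def P_def by blast
qed

section \<open>Tensor fields and metrics\<close>

lemma smooth_on_differentiable: "smooth_on S f \<Longrightarrow> x \<in> S \<Longrightarrow> f differentiable (at x)"
  unfolding smooth_on_def by (metis iter_deriv.simps(1))

lemma smooth_on_continuous_on: "smooth_on S f \<Longrightarrow> continuous_on S f"
  by (intro continuous_at_imp_continuous_on ballI differentiable_imp_continuous_within
      smooth_on_differentiable)

text \<open>The induction hypothesis is an identity on \<open>S\<close> only; since \<open>S\<close>
  is open it holds near each of its points and can be differentiated there.\<close>

lemma iter_deriv_lincomb:
  assumes S: "open S" and f: "smooth_on S f" and g: "smooth_on S g"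
  shows "\<forall>x\<in>S. iter_deriv vs (\<lambda>x. a *\<^sub>R f x + b *\<^sub>R g x) x = a *\<^sub>R iter_deriv vs f x + b *\<^sub>R iter_deriv vs g x"
    (is "\<forall>x\<in>S. ?F vs x = ?G vs x")
proof (induction vs)
  case (Cons v vs)
  show ?case
  proof
    fix x assume x: "x \<in> S"
    have "(?G vs has_derivative (\<lambda>w. a *\<^sub>R frechet_derivative (iter_deriv vs f) (at x) w +
        b *\<^sub>R frechet_derivative (iter_deriv vs g) (at x) w)) (at x)"
      using f g x unfolding smooth_on_def
      by (intro derivative_intros) (auto simp: frechet_derivative_works[symmetric])
    then have "(?F vs has_derivative (\<lambda>w. a *\<^sub>R frechet_derivative (iter_deriv vs f) (at x) w +
        b *\<^sub>R frechet_derivative (iter_deriv vs g) (at x) w)) (at x)"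
      by (rule has_derivative_transform_within_open[OF _ S x]) (use Cons in auto)
    from frechet_derivative_at[OF this, symmetric] show "?F (v # vs) x = ?G (v # vs) x"
      by simp
  qed
qed auto

lemma smooth_on_lincomb:
  assumes S: "open S" and f: "smooth_on S f" and g: "smooth_on S g"
  shows "smooth_on S (\<lambda>x. a *\<^sub>R f x + b *\<^sub>R g x)"
  unfolding smooth_on_def
proof (intro allI ballI)
  fix vs x assume x: "x \<in> S"
  have "(\<lambda>x. a *\<^sub>R iter_deriv vs f x + b *\<^sub>R iter_deriv vs g x) differentiable (at x)"
    using f g x unfolding smooth_on_def by (intro derivative_intros) auto
  then obtain D where "((\<lambda>x. a *\<^sub>R iter_deriv vs f x + b *\<^sub>R iter_deriv vs g x) has_derivative D) (at x)"
    unfolding differentiable_def by blast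
  then have "(iter_deriv vs (\<lambda>x. a *\<^sub>R f x + b *\<^sub>R g x) has_derivative D) (at x)"
    by (rule has_derivative_transform_within_open[OF _ S x]) (simp add: iter_deriv_lincomb[OF S f g])
  then show "iter_deriv vs (\<lambda>x. a *\<^sub>R f x + b *\<^sub>R g x) differentiable (at x)"
    by (rule differentiableI)
qed

section \<open>Tensor fields and the cone of metrics\<close>

lemma tensor_scaleR_apply: "(a *\<^sub>R h) c p = a *\<^sub>R h c p" for h :: "('m, 'n::finite) tensor2"
  by (simp add: scaleR_fun_def)

lemma sym_tensor_transform:
  assumes "h \<in> sym_tensors A" "c \<in> A" "d \<in> A" "p \<in> chart_dom c" "p \<in> chart_dom d"
  shows "h c p = transpose (transition_jacobian c d p) ** h d p ** transition_jacobian c d p"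
  using assms unfolding sym_tensors_def by blast

lemma sym_tensor_symmetric:
  "h \<in> sym_tensors A \<Longrightarrow> c \<in> A \<Longrightarrow> p \<in> chart_dom c \<Longrightarrow> transpose (h c p) = h c p"
  unfolding sym_tensors_def by blast

lemma sym_tensor_vanishes: "h \<in> sym_tensors A \<Longrightarrow> c \<notin> A \<or> p \<notin> chart_dom c \<Longrightarrow> h c p = 0"
  unfolding sym_tensors_def by blast

lemma riem_metric_sym: "g \<in> riem_metrics A \<Longrightarrow> g \<in> sym_tensors A"
  by (simp add: riem_metrics_def)

lemma riem_metric_pos:
  "g \<in> riem_metrics A \<Longrightarrow> c \<in> A \<Longrightarrow> p \<in> chart_dom c \<Longrightarrow> v \<noteq> 0 \<Longrightarrow> 0 < v \<bullet> (g c p *v v)"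
  by (simp add: riem_metrics_def)

lemma riem_metric_det_pos:
  "g \<in> riem_metrics A \<Longrightarrow> c \<in> A \<Longrightarrow> p \<in> chart_dom c \<Longrightarrow> 0 < det (g c p)"
  by (intro positive_definite_det_pos riem_metric_pos)

text \<open>Positivity is a pointwise matter. Membership in \<open>sym_tensors\<close> is assumed
  here because closure under linear combinations will rest on the chart images being open.\<close>

lemma riem_metrics_convex:
  assumes g: "g \<in> riem_metrics A" and k: "k \<in> riem_metrics A" and t: "0 \<le> t" "t \<le> 1"
    and sym: "(1 - t) *\<^sub>R g + t *\<^sub>R k \<in> sym_tensors A"
  shows "(1 - t) *\<^sub>R g + t *\<^sub>R k \<in> riem_metrics A"
proof -
  have "0 < v \<bullet> (((1 - t) *\<^sub>R g + t *\<^sub>R k) c p *v v)"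
    if c: "c \<in> A" and p: "p \<in> chart_dom c" and v: "v \<noteq> 0" for c p v
  proof -
    have "0 < (1 - t) * (v \<bullet> (g c p *v v)) + t * (v \<bullet> (k c p *v v))"
      using t riem_metric_pos[OF g c p v] riem_metric_pos[OF k c p v]
      \<comment> \<open>For \<open>t = 1\<close> the first summand vanishes and the second is
        positive; otherwise the first is positive.\<close>
      by (cases "t = 1") (auto intro!: add_pos_nonneg mult_pos_pos mult_nonneg_nonneg)
    then show ?thesis
      by (simp add: tensor_scaleR_apply matrix_vector_mult_add_rdistrib
          scaleR_matrix_vector_assoc[symmetric] inner_add_right)
  qed
  with sym show ?thesis
    by (simp add: riem_metrics_def)
qed

definition volume_density :: "('m, 'n::finite) tensor2 \<Rightarrow> ('m, 'n) chart \<Rightarrow> real^'n \<Rightarrow> real"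
  where "volume_density g c x = sqrt (det (g c (chart_inv c x)))"

section \<open>Charts of a closed manifold\<close>

locale closed_manifold =
  fixes A :: "('m::t2_space, 'n::finite) chart set"
  assumes compact_manifold: "compact (UNIV :: 'm set)"
    and atlas: "smooth_atlas A"
begin

lemma open_chart_dom: "c \<in> A \<Longrightarrow> open (chart_dom c)"
  and open_chart_image: "c \<in> A \<Longrightarrow> open (chart_map c ` chart_dom c)"
  and continuous_on_chart_map: "c \<in> A \<Longrightarrow> continuous_on (chart_dom c) (chart_map c)"
  and continuous_on_chart_inv: "c \<in> A \<Longrightarrow> continuous_on (chart_map c ` chart_dom c) (chart_inv c)"
  and chart_inv_map: "c \<in> A \<Longrightarrow> p \<in> chart_dom c \<Longrightarrow> chart_inv c (chart_map c p) = p"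
proof -
  assume "c \<in> A"
  then have "open (chart_dom c)" "open (chart_map c ` chart_dom c)"
    and hom: "homeomorphism (chart_dom c) (chart_map c ` chart_dom c) (chart_map c) (chart_inv c)"
    using atlas unfolding smooth_atlas_def by (elim conjE; blast)+
  then show "open (chart_dom c)" "open (chart_map c ` chart_dom c)"
    by blast+
  show "continuous_on (chart_dom c) (chart_map c)"
    "continuous_on (chart_map c ` chart_dom c) (chart_inv c)"
    using hom by (blast intro: homeomorphism_cont1 homeomorphism_cont2)+
  show "chart_inv c (chart_map c p) = p" if "p \<in> chart_dom c"
    using hom that by (rule homeomorphism_apply1)
qed

lemma inj_on_chart_map: "c \<in> A \<Longrightarrow> inj_on (chart_map c) (chart_dom c)"
  by (metis chart_inv_map inj_onI)

lemma smooth_on_transition: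
  "c \<in> A \<Longrightarrow> d \<in> A \<Longrightarrow> smooth_on (chart_map c ` (chart_dom c \<inter> chart_dom d)) (transition c d)"
  using atlas unfolding smooth_atlas_def by (elim conjE) blast

lemma chart_cover: "\<exists>c\<in>A. p \<in> chart_dom c"
proof -
  have "(\<Union>c\<in>A. chart_dom c) = UNIV"
    using atlas unfolding smooth_atlas_def by (elim conjE)
  then show ?thesis
    by blast
qed

lemma chart_at: "chart_at A p \<in> A" "p \<in> chart_dom (chart_at A p)"
proof -
  have "chart_at A p \<in> A \<and> p \<in> chart_dom (chart_at A p)"
    unfolding chart_at_def by (rule someI_ex) (use chart_cover in blast)
  then show "chart_at A p \<in> A" "p \<in> chart_dom (chart_at A p)"
    by auto
qed

lemma sym_tensor_smooth:
  "h \<in> sym_tensors A \<Longrightarrow> c \<in> A \<Longrightarrow> smooth_on (chart_map c ` chart_dom c) (\<lambda>x. h c (chart_inv c x))"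
  unfolding sym_tensors_def by blast

lemma sym_tensor_continuous:
  "h \<in> sym_tensors A \<Longrightarrow> c \<in> A \<Longrightarrow> continuous_on (chart_map c ` chart_dom c) (\<lambda>x. h c (chart_inv c x))"
  by (intro smooth_on_continuous_on sym_tensor_smooth)

lemma sym_tensors_lincomb:
  assumes h: "h \<in> sym_tensors A" and k: "k \<in> sym_tensors A"
  shows "a *\<^sub>R h + b *\<^sub>R k \<in> sym_tensors A"
proof -
  have eq: "(a *\<^sub>R h + b *\<^sub>R k) c p = a *\<^sub>R h c p + b *\<^sub>R k c p" for c p
    by (simp add: tensor_scaleR_apply)
  have "transpose (a *\<^sub>R h c p + b *\<^sub>R k c p) = a *\<^sub>R h c p + b *\<^sub>R k c p"
    if "c \<in> A" "p \<in> chart_dom c" for c p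
  proof -
    have "transpose (h c p) = h c p" "transpose (k c p) = k c p"
      by (rule sym_tensor_symmetric[OF h that], rule sym_tensor_symmetric[OF k that])
    then show ?thesis
      by (simp add: transpose_def vec_eq_iff)
  qed
  moreover have "a *\<^sub>R h c p + b *\<^sub>R k c p =
      transpose (transition_jacobian c d p) ** (a *\<^sub>R h d p + b *\<^sub>R k d p) ** transition_jacobian c d p"
    if "c \<in> A" "d \<in> A" "p \<in> chart_dom c \<inter> chart_dom d" for c d p
  proof -
    let ?J = "transition_jacobian c d p"
    have "transpose ?J ** (a *\<^sub>R h d p + b *\<^sub>R k d p) ** ?J =
        a *\<^sub>R (transpose ?J ** h d p ** ?J) + b *\<^sub>R (transpose ?J ** k d p ** ?J)"
      by (simp add: matrix_matrix_mult_def vec_eq_iff sum.distrib sum_distrib_left sum_distrib_right algebra_simps)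
    moreover have "h c p = transpose ?J ** h d p ** ?J" "k c p = transpose ?J ** k d p ** ?J"
      using that by (auto intro: sym_tensor_transform[OF h] sym_tensor_transform[OF k])
    ultimately show ?thesis
      by simp
  qed
  moreover have "smooth_on (chart_map c ` chart_dom c) (\<lambda>x. a *\<^sub>R h c (chart_inv c x) + b *\<^sub>R k c (chart_inv c x))"
    if "c \<in> A" for c
    by (intro smooth_on_lincomb open_chart_image sym_tensor_smooth h k that)
  moreover have "a *\<^sub>R h c p + b *\<^sub>R k c p = 0" if "c \<notin> A \<or> p \<notin> chart_dom c" for c p
    using sym_tensor_vanishes[OF h that] sym_tensor_vanishes[OF k that] by simp
  ultimately show ?thesis
    unfolding sym_tensors_def mem_Collect_eq eq by blast
qed

text \<open>A measurable stand-in for a partition of unity. Each point has an open neighbourhood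
  whose coordinate image lies in a closed ball inside the chart image; compactness leaves finitely
  many, and removing the earlier ones makes them disjoint. The pieces \<open>D i\<close> need not be
  compact, so the compact sets \<open>K i\<close> are recorded with them.\<close>

lemma finite_borel_partition:
  obtains m :: nat and c :: "nat \<Rightarrow> ('m, 'n) chart" and K :: "nat \<Rightarrow> (real^'n) set" and D :: "nat \<Rightarrow> 'm set"
  where "\<And>i. i < m \<Longrightarrow> c i \<in> A" "\<And>i. i < m \<Longrightarrow> compact (K i)"
    "\<And>i. i < m \<Longrightarrow> K i \<subseteq> chart_map (c i) ` chart_dom (c i)" "\<And>i. i < m \<Longrightarrow> D i \<in> sets borel"
    "\<And>i. i < m \<Longrightarrow> D i \<subseteq> chart_dom (c i)" "\<And>i. i < m \<Longrightarrow> chart_map (c i) ` D i \<subseteq> K i"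
    "disjoint_family_on D {..<m}" "(\<Union>i<m. D i) = UNIV"
proof -
  have "\<exists>c K W. c \<in> A \<and> compact K \<and> K \<subseteq> chart_map c ` chart_dom c \<and> open W \<and> p \<in> W \<and>
      W \<subseteq> chart_dom c \<and> chart_map c ` W \<subseteq> K" for p
  proof -
    obtain c where c: "c \<in> A" "p \<in> chart_dom c"
      using chart_cover by blast
    then obtain r where r: "0 < r" "cball (chart_map c p) r \<subseteq> chart_map c ` chart_dom c"
      using open_chart_image[OF c(1)] unfolding open_contains_cball by blast
    have "open (chart_dom c \<inter> chart_map c -` ball (chart_map c p) r)"
      by (rule continuous_open_preimage[OF continuous_on_chart_map[OF c(1)] open_chart_dom[OF c(1)] open_ball])
    then show ?thesis
      using c r by (intro exI[of _ c] exI[of _ "cball (chart_map c p) r"]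
          exI[of _ "chart_dom c \<inter> chart_map c -` ball (chart_map c p) r"]) auto
  qed
  then obtain c K W where cKW: "\<And>p. c p \<in> A \<and> compact (K p) \<and> K p \<subseteq> chart_map (c p) ` chart_dom (c p) \<and>
      open (W p) \<and> p \<in> W p \<and> W p \<subseteq> chart_dom (c p) \<and> chart_map (c p) ` W p \<subseteq> K p"
    by metis
  obtain T where T: "finite T" "UNIV \<subseteq> (\<Union>p\<in>T. W p)"
    using compactE_image[OF compact_manifold, of UNIV W thesis] cKW by blast
  obtain e where e: "bij_betw e {0..<card T} T"
    using ex_bij_betw_nat_finite[OF T(1)] by blast
  have We: "(\<Union>i<card T. W (e i)) = UNIV"
  proof -
    have "e ` {..<card T} = T"
      using bij_betw_imp_surj_on[OF e] by (simp add: lessThan_atLeast0)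
    then have "(\<Union>i<card T. W (e i)) = (\<Union>p\<in>T. W p)"
      by (metis image_image)
    then show ?thesis
      using T(2) by auto
  qed
  \<comment> \<open>\<open>e\<close> enumerates the finite subcover; a point belongs to the piece of
    least index whose neighbourhood contains it.\<close>
  define D where "D = (\<lambda>i. W (e i) - (\<Union>j<i. W (e j)))"
  have "p \<in> (\<Union>i<card T. D i)" for p
  proof -
    define i where "i = (LEAST i. p \<in> W (e i))"
    obtain j where j: "j < card T" "p \<in> W (e j)"
      using We by blast
    then have "i \<le> j" "p \<in> W (e i)"
      unfolding i_def by (auto intro: Least_le LeastI)
    moreover have "p \<notin> W (e k)" if "k < i" for k
      using that not_less_Least unfolding i_def by blast
    ultimately show ?thesis
      using j by (auto simp: D_def intro!: bexI[of _ i])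
  qed
  then have U: "(\<Union>i<card T. D i) = UNIV"
    by blast
  have disj: "disjoint_family_on D {..<card T}"
  proof -
    have "D i \<inter> D j = {}" if "i < j" for i j
      using that by (auto simp: D_def)
    then show ?thesis
      unfolding disjoint_family_on_def by (metis inf_commute linorder_neqE_nat)
  qed
  show ?thesis
  proof (rule that[of "card T" "\<lambda>i. c (e i)" "\<lambda>i. K (e i)" D])
    show "D i \<in> sets borel" for i
      using cKW unfolding D_def by (intro sets.Diff sets.finite_UN) auto
  qed (use cKW U disj in \<open>auto simp: D_def\<close>)
qed

text \<open>Positivity has to be secured on finitely many compact sets \<open>K i\<close> only,
  where it is stable under small perturbations. The transformation law carries it to every other
  chart.\<close>

lemma riem_metrics_open_line:
  assumes g: "g \<in> riem_metrics A" and h: "h \<in> sym_tensors A"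
  obtains e where "0 < e" "\<And>t. \<bar>t\<bar> \<le> e \<Longrightarrow> g + t *\<^sub>R h \<in> riem_metrics A"
proof -
  obtain m :: nat and c K D where part: "\<And>i. i < m \<Longrightarrow> c i \<in> A" "\<And>i. i < m \<Longrightarrow> compact (K i)"
    "\<And>i. i < m \<Longrightarrow> K i \<subseteq> chart_map (c i) ` chart_dom (c i)" "\<And>i. i < m \<Longrightarrow> D i \<in> sets borel"
    "\<And>i. i < m \<Longrightarrow> D i \<subseteq> chart_dom (c i)" "\<And>i. i < m \<Longrightarrow> chart_map (c i) ` D i \<subseteq> K i"
    "disjoint_family_on D {..<m}" "(\<Union>i<m. D i) = UNIV"
    by (rule finite_borel_partition) blast
  note gs = riem_metric_sym[OF g]
  have "\<exists>e>0. \<forall>t x v. \<bar>t\<bar> \<le> e \<longrightarrow> x \<in> K i \<longrightarrow> v \<noteq> 0 \<longrightarrow>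
      0 < v \<bullet> ((g (c i) (chart_inv (c i) x) + t *\<^sub>R h (c i) (chart_inv (c i) x)) *v v)" if i: "i < m" for i
  proof (rule positive_definite_perturb[OF part(2)[OF i]])
    show "continuous_on (K i) (\<lambda>x. g (c i) (chart_inv (c i) x))"
      "continuous_on (K i) (\<lambda>x. h (c i) (chart_inv (c i) x))"
      using continuous_on_subset[OF sym_tensor_continuous part(3)[OF i]] gs h part(1)[OF i] by blast+
    show "0 < v \<bullet> (g (c i) (chart_inv (c i) x) *v v)" if "x \<in> K i" "v \<noteq> 0" for x v
      using that part(1,3)[OF i] by (intro riem_metric_pos[OF g]) (auto simp: inv_into_into)
  qed
  then obtain e where e: "\<And>i. i < m \<Longrightarrow> 0 < e i"
    "\<And>i t x v. i < m \<Longrightarrow> \<bar>t\<bar> \<le> e i \<Longrightarrow> x \<in> K i \<Longrightarrow> v \<noteq> 0 \<Longrightarrow>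
      0 < v \<bullet> ((g (c i) (chart_inv (c i) x) + t *\<^sub>R h (c i) (chart_inv (c i) x)) *v v)"
    by metis
  \<comment> \<open>Inserting 1 keeps the set nonempty for \<open>Min\<close> whatever
    \<open>m\<close> is.\<close>
  define e0 where "e0 = Min (insert 1 (e ` {..<m}))"
  have "0 < e0"
    using e(1) by (auto simp: e0_def)
  have e0: "e0 \<le> e i" if "i < m" for i
    using that unfolding e0_def by (intro Min_le) auto
  have "g + t *\<^sub>R h \<in> riem_metrics A" if t: "\<bar>t\<bar> \<le> e0" for t
  proof -
    have sym: "g + t *\<^sub>R h \<in> sym_tensors A"
      using sym_tensors_lincomb[OF gs h, of 1 t] by simp
    have "0 < v \<bullet> ((g + t *\<^sub>R h) d p *v v)" if d: "d \<in> A" "p \<in> chart_dom d" "v \<noteq> 0" for d p v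
    proof -
      obtain i where i: "i < m" "p \<in> D i"
        using part(8) by blast
      let ?J = "transition_jacobian d (c i) p"
      have p: "p \<in> chart_dom (c i)"
        using part(5) i by blast
      \<comment> \<open>The form of a tensor field in the chart \<open>d\<close> is its form in
        \<open>c i\<close> evaluated on the transformed vector.\<close>
      have J: "w \<bullet> (k d p *v w) = (?J *v w) \<bullet> (k (c i) p *v (?J *v w))" if "k \<in> sym_tensors A" for k w
      proof -
        have "w \<bullet> (k d p *v w) = w \<bullet> (transpose ?J *v (k (c i) p *v (?J *v w)))"
          by (simp add: sym_tensor_transform[OF that d(1) part(1)[OF i(1)] d(2) p] matrix_vector_mul_assoc matrix_mul_assoc)
        then show ?thesis
          using dot_lmul_matrix[of w "transpose ?J" "k (c i) p *v (?J *v w)"]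
          by (simp add: vector_transpose_matrix)
      qed
      \<comment> \<open>If the Jacobian killed \<open>v\<close>, this formula would make the form of
        \<open>g\<close> vanish on \<open>v\<close>, contrary to positivity; no inverse transition
        map is involved.\<close>
      have "?J *v v \<noteq> 0"
        using riem_metric_pos[OF g d] J[OF gs, of v] by auto
      moreover have "chart_map (c i) p \<in> K i"
        using part(6) i by blast
      moreover have "\<bar>t\<bar> \<le> e i"
        using t e0[OF i(1)] by simp
      ultimately have "0 < (?J *v v) \<bullet> ((g (c i) p + t *\<^sub>R h (c i) p) *v (?J *v v))"
        using e(2)[OF i(1), of t "chart_map (c i) p" "?J *v v"] chart_inv_map[OF part(1)[OF i(1)] p] by simp
      then show ?thesis
        unfolding J[OF sym] by (simp add: tensor_scaleR_apply)
    qed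
    with sym show ?thesis
      by (simp add: riem_metrics_def)
  qed
  with \<open>0 < e0\<close> show ?thesis
    by (rule that)
qed

end

section \<open>The Riemannian volume\<close>

context closed_manifold
begin

text \<open>The image is a preimage under the inverse chart, which is continuous on an open
  set.\<close>

lemma chart_image_borel:
  assumes c: "c \<in> A" and B: "B \<in> sets borel" "B \<subseteq> chart_dom c"
  shows "chart_map c ` B \<in> sets borel"
proof -
  let ?U = "chart_map c ` chart_dom c"
  have eq: "chart_map c ` B = chart_inv c -` B \<inter> ?U"
  proof
    show "chart_map c ` B \<subseteq> chart_inv c -` B \<inter> ?U"
      using B(2) chart_inv_map[OF c] by auto
    show "chart_inv c -` B \<inter> ?U \<subseteq> chart_map c ` B"
    proof
      fix x assume x: "x \<in> chart_inv c -` B \<inter> ?U"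
      then have "x = chart_map c (chart_inv c x)"
        by (simp add: f_inv_into_f)
      with x show "x \<in> chart_map c ` B"
        by blast
    qed
  qed
  have "chart_inv c \<in> borel_measurable (restrict_space borel ?U)"
    by (rule borel_measurable_continuous_on_restrict[OF continuous_on_chart_inv[OF c]])
  from measurable_sets[OF this B(1)] have "chart_inv c -` B \<inter> ?U \<in> sets (restrict_space borel ?U)"
    by (simp add: space_restrict_space)
  then show ?thesis
    using borel_open[OF open_chart_image[OF c]] by (simp add: eq sets_restrict_space_iff)
qed

lemma continuous_on_volume_density:
  "g \<in> sym_tensors A \<Longrightarrow> c \<in> A \<Longrightarrow> continuous_on (chart_map c ` chart_dom c) (volume_density g c)"
  unfolding volume_density_def by (intro continuous_intros sym_tensor_continuous)

lemma volume_density_pos: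
  "g \<in> riem_metrics A \<Longrightarrow> c \<in> A \<Longrightarrow> x \<in> chart_map c ` chart_dom c \<Longrightarrow> 0 < volume_density g c x"
  unfolding volume_density_def by (simp add: riem_metric_det_pos inv_into_into)

text \<open>By the transformation law det g picks up the square of the Jacobian determinant, so its
  root picks up the absolute value, exactly the factor in the change of variables. The compact
  \<open>K\<close> makes the integral in the chart \<open>d\<close> finite.\<close>

lemma volume_chart_change:
  assumes g: "g \<in> riem_metrics A" and c: "c \<in> A" and d: "d \<in> A"
    and B: "B \<in> sets borel" "B \<subseteq> chart_dom c" "B \<subseteq> chart_dom d"
    and K: "compact K" "chart_map d ` B \<subseteq> K" "K \<subseteq> chart_map d ` chart_dom d"
  shows "(\<integral>\<^sup>+x\<in>chart_map c ` B. ennreal (volume_density g c x) \<partial>lborel) =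
    (\<integral>\<^sup>+x\<in>chart_map d ` B. ennreal (volume_density g d x) \<partial>lborel)"
proof -
  let ?S = "chart_map c ` B" and ?\<tau> = "transition c d"
  let ?J = "\<lambda>x. matrix (frechet_derivative ?\<tau> (at x))"
  have gs: "g \<in> sym_tensors A"
    using g by (rule riem_metric_sym)
  have \<tau>: "?\<tau> (chart_map c p) = chart_map d p" if "p \<in> B" for p
    using that B(2) chart_inv_map[OF c] by (auto simp: transition_def)
  have im: "?\<tau> ` ?S = chart_map d ` B"
    using \<tau> by (simp add: image_image)
  have Sm: "?S \<in> sets borel" "chart_map d ` B \<in> sets borel"
    using B c d by (auto intro: chart_image_borel)
  have dens: "\<bar>det (?J x)\<bar> * volume_density g d (?\<tau> x) = volume_density g c x" if x: "x \<in> ?S" for x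
  proof -
    obtain p where p: "p \<in> B" "x = chart_map c p"
      using x by blast
    let ?P = "transition_jacobian c d p"
    have pcd: "p \<in> chart_dom c" "p \<in> chart_dom d"
      using p B by auto
    have "det (g c p) = det ?P * det ?P * det (g d p)"
      unfolding sym_tensor_transform[OF gs c d pcd] by (simp add: det_mul mult_ac)
    then have "sqrt (det (g c p)) = \<bar>det ?P\<bar> * sqrt (det (g d p))"
      by (simp add: real_sqrt_mult)
    then show ?thesis
      unfolding p(2) \<tau>[OF p(1)] volume_density_def chart_inv_map[OF c pcd(1)] chart_inv_map[OF d pcd(2)]
        transition_jacobian_def by simp
  qed
  have "(\<integral>\<^sup>+x. ennreal (indicator ?S x * (\<bar>det (?J x)\<bar> * volume_density g d (?\<tau> x))) \<partial>lborel) =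
      (\<integral>\<^sup>+y. ennreal (indicator (?\<tau> ` ?S) y * volume_density g d y) \<partial>lborel)"
  proof (rule nn_integral_change_of_variables[OF Sm(1)])
    fix x assume "x \<in> ?S"
    then have "x \<in> chart_map c ` (chart_dom c \<inter> chart_dom d)"
      using B by blast
    then show "(?\<tau> has_derivative frechet_derivative ?\<tau> (at x)) (at x)"
      using smooth_on_differentiable[OF smooth_on_transition[OF c d]] frechet_derivative_works by blast
  next
    show "inj_on ?\<tau> ?S"
      using inj_onD[OF inj_on_chart_map[OF d]] B(3) by (auto simp: inj_on_def \<tau> subset_iff)
    show "0 \<le> volume_density g d y" if "y \<in> ?\<tau> ` ?S" for y
      using volume_density_pos[OF g d, of y] that B(3) unfolding im by fastforce
    have cK: "continuous_on K (volume_density g d)"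
      using continuous_on_volume_density[OF gs d] K(3) by (rule continuous_on_subset)
    have int: "integrable lborel (\<lambda>y. indicator (?\<tau> ` ?S) y * volume_density g d y)"
      unfolding im by (rule integrable_indicator_compact[OF K(1) cK K(2) Sm(2)])
    then show "(\<lambda>y. indicator (?\<tau> ` ?S) y * volume_density g d y) \<in> borel_measurable borel"
      using borel_measurable_integrable by fastforce
    have "(\<integral>\<^sup>+y. ennreal (indicator (?\<tau> ` ?S) y * volume_density g d y) \<partial>lborel) \<le>
        (\<integral>\<^sup>+y. ennreal (norm (indicator (?\<tau> ` ?S) y * volume_density g d y)) \<partial>lborel)"
      by (intro nn_integral_mono ennreal_leI) simp
    also have "\<dots> < \<infinity>"
      using int unfolding integrable_iff_bounded by blast
    finally show "(\<integral>\<^sup>+y. ennreal (indicator (?\<tau> ` ?S) y * volume_density g d y) \<partial>lborel) < \<infinity>" .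
    \<comment> \<open>By \<open>dens\<close> the transformed integrand is the density in the chart
      \<open>c\<close>, which is continuous there; this settles measurability without examining the
      Jacobian.\<close>
    have "(\<lambda>x. indicator ?S x *\<^sub>R volume_density g c x) \<in> borel_measurable borel"
      using B(2) by (intro borel_measurable_continuous_on_indicator Sm
          continuous_on_subset[OF continuous_on_volume_density[OF gs c]]) auto
    also have "(\<lambda>x. indicator ?S x *\<^sub>R volume_density g c x) =
        (\<lambda>x. indicator ?S x * (\<bar>det (?J x)\<bar> * volume_density g d (?\<tau> x)))"
      using dens by (auto simp: indicator_def fun_eq_iff)
    finally show "(\<lambda>x. indicator ?S x * (\<bar>det (?J x)\<bar> * volume_density g d (?\<tau> x))) \<in> borel_measurable borel" .
  qed
  moreover have "(\<integral>\<^sup>+x\<in>?S. ennreal (volume_density g c x) \<partial>lborel) =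
      (\<integral>\<^sup>+x. ennreal (indicator ?S x * (\<bar>det (?J x)\<bar> * volume_density g d (?\<tau> x))) \<partial>lborel)"
    by (intro nn_integral_cong) (auto simp: indicator_def dens)
  moreover have "(\<integral>\<^sup>+x\<in>chart_map d ` B. ennreal (volume_density g d x) \<partial>lborel) =
      (\<integral>\<^sup>+y. ennreal (indicator (?\<tau> ` ?S) y * volume_density g d y) \<partial>lborel)"
    unfolding im by (intro nn_integral_cong) (auto simp: indicator_def)
  ultimately show ?thesis
    by simp
qed

text \<open>The indicator extends the density by zero, so that it is Borel measurable on the whole
  space and defines a measure there.\<close>

definition chart_measure :: "('m, 'n) tensor2 \<Rightarrow> ('m, 'n) chart \<Rightarrow> (real^'n) measure"
  where "chart_measure g c =
    density lborel (\<lambda>x. ennreal (indicator (chart_map c ` chart_dom c) x *\<^sub>R volume_density g c x))"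

lemma sets_chart_measure [simp]: "sets (chart_measure g c) = sets borel"
  by (simp add: chart_measure_def)

lemma emeasure_chart_measure:
  assumes "g \<in> riem_metrics A" "c \<in> A" "S \<in> sets borel" "S \<subseteq> chart_map c ` chart_dom c"
  shows "emeasure (chart_measure g c) S = (\<integral>\<^sup>+x\<in>S. ennreal (volume_density g c x) \<partial>lborel)"
proof -
  have "(\<lambda>x. indicator (chart_map c ` chart_dom c) x *\<^sub>R volume_density g c x) \<in> borel_measurable borel"
    using assms by (intro borel_measurable_continuous_on_indicator continuous_on_volume_density
        borel_open open_chart_image riem_metric_sym)
  then have "emeasure (chart_measure g c) S =
      (\<integral>\<^sup>+x\<in>S. ennreal (indicator (chart_map c ` chart_dom c) x *\<^sub>R volume_density g c x) \<partial>lborel)"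
    unfolding chart_measure_def using assms(3) by (subst emeasure_density) auto
  also have "\<dots> = (\<integral>\<^sup>+x\<in>S. ennreal (volume_density g c x) \<partial>lborel)"
    using assms(4) by (intro nn_integral_cong) (auto simp: indicator_def)
  finally show ?thesis .
qed

text \<open>The property under the definite description in \<open>riem_volume\<close>.\<close>

definition is_volume :: "('m, 'n) tensor2 \<Rightarrow> 'm measure \<Rightarrow> bool"
  where "is_volume g \<mu> \<longleftrightarrow> sets \<mu> = sets borel \<and>
    (\<forall>c\<in>A. \<forall>B\<in>sets borel. B \<subseteq> chart_dom c \<longrightarrow>
       emeasure \<mu> B =
         (\<integral>\<^sup>+x\<in>chart_map c ` B. ennreal (volume_density g c x) \<partial>lborel))"

text \<open>A Borel set splits into finitely many pieces, each inside one chart, where both measures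
  have the prescribed value.\<close>

lemma is_volume_unique:
  assumes "is_volume g \<mu>" "is_volume g \<nu>"
  shows "\<mu> = \<nu>"
proof (rule measure_eqI)
  show "sets \<mu> = sets \<nu>"
    using assms by (simp add: is_volume_def)
  fix B assume "B \<in> sets \<mu>"
  then have B: "B \<in> sets borel"
    using assms by (simp add: is_volume_def)
  obtain m :: nat and c K D where part: "\<And>i. i < m \<Longrightarrow> c i \<in> A" "\<And>i. i < m \<Longrightarrow> compact (K i)"
    "\<And>i. i < m \<Longrightarrow> K i \<subseteq> chart_map (c i) ` chart_dom (c i)" "\<And>i. i < m \<Longrightarrow> D i \<in> sets borel"
    "\<And>i. i < m \<Longrightarrow> D i \<subseteq> chart_dom (c i)" "\<And>i. i < m \<Longrightarrow> chart_map (c i) ` D i \<subseteq> K i"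
    "disjoint_family_on D {..<m}" "(\<Union>i<m. D i) = UNIV"
    by (rule finite_borel_partition) blast
  have sum: "emeasure \<rho> B = (\<Sum>i<m. emeasure \<rho> (B \<inter> D i))" if "sets \<rho> = sets borel" for \<rho>
    using part B that by (intro sum_emeasure_cover) auto
  have "emeasure \<mu> (B \<inter> D i) = emeasure \<nu> (B \<inter> D i)" if "i < m" for i
  proof -
    have "B \<inter> D i \<in> sets borel" "B \<inter> D i \<subseteq> chart_dom (c i)"
      using that part(4,5)[OF that] B by auto
    then show ?thesis
      using assms part(1)[OF that] unfolding is_volume_def by presburger
  qed
  then show "emeasure \<mu> B = emeasure \<nu> B"
    using assms by (simp add: sum is_volume_def)
qed

text \<open>The chart measures of the partition pieces are added up. Countable additivity is
  inherited from them since charts are injective; on a set inside an arbitrary chart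
  \<open>d\<close>, each piece can be recomputed in \<open>d\<close>, so the sum has the value
  required there.\<close>

lemma is_volume_exists:
  assumes g: "g \<in> riem_metrics A"
  shows "\<exists>\<mu>. is_volume g \<mu>"
proof -
  obtain m :: nat and c K D where part: "\<And>i. i < m \<Longrightarrow> c i \<in> A" "\<And>i. i < m \<Longrightarrow> compact (K i)"
    "\<And>i. i < m \<Longrightarrow> K i \<subseteq> chart_map (c i) ` chart_dom (c i)" "\<And>i. i < m \<Longrightarrow> D i \<in> sets borel"
    "\<And>i. i < m \<Longrightarrow> D i \<subseteq> chart_dom (c i)" "\<And>i. i < m \<Longrightarrow> chart_map (c i) ` D i \<subseteq> K i"
    "disjoint_family_on D {..<m}" "(\<Union>i<m. D i) = UNIV"
    by (rule finite_borel_partition) blast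
  define F where "F = (\<lambda>B. \<Sum>i<m. emeasure (chart_measure g (c i)) (chart_map (c i) ` (B \<inter> D i)))"
  define \<mu> :: "'m measure" where "\<mu> = measure_of UNIV (sets borel) F"
  have im: "chart_map (c i) ` (B \<inter> D i) \<in> sets borel" if "i < m" "B \<in> sets borel" for i B
    using that part(1,4,5)[OF that(1)] by (intro chart_image_borel) auto
  have "countably_additive (sets borel) F"
  proof (rule countably_additiveI)
    fix B :: "nat \<Rightarrow> 'm set"
    assume B: "range B \<subseteq> sets borel" "disjoint_family B"
    have "(\<Sum>k. emeasure (chart_measure g (c i)) (chart_map (c i) ` (B k \<inter> D i))) =
        emeasure (chart_measure g (c i)) (chart_map (c i) ` ((\<Union>k. B k) \<inter> D i))" if i: "i < m" for i
    proof -
      have "disjoint_family (\<lambda>k. chart_map (c i) ` (B k \<inter> D i))"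
        unfolding disjoint_family_on_def
      proof (intro ballI impI)
        fix k l :: nat assume "k \<noteq> l"
        then have "(B k \<inter> D i) \<inter> (B l \<inter> D i) = {}"
          using B(2) unfolding disjoint_family_on_def by blast
        moreover have "inj_on (chart_map (c i)) (D i)"
          using inj_on_chart_map[OF part(1)[OF i]] part(5)[OF i] by (rule inj_on_subset)
        ultimately show "chart_map (c i) ` (B k \<inter> D i) \<inter> chart_map (c i) ` (B l \<inter> D i) = {}"
          by (subst inj_on_image_Int[symmetric, where C = "D i"]) auto
      qed
      moreover have "range (\<lambda>k. chart_map (c i) ` (B k \<inter> D i)) \<subseteq> sets (chart_measure g (c i))"
        using im[OF i] B(1) by auto
      ultimately have "(\<Sum>k. emeasure (chart_measure g (c i)) (chart_map (c i) ` (B k \<inter> D i))) =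
          emeasure (chart_measure g (c i)) (\<Union>k. chart_map (c i) ` (B k \<inter> D i))"
        by (intro suminf_emeasure)
      then show ?thesis
        by (simp add: image_UN[symmetric] Int_UN_distrib2)
    qed
    then show "(\<Sum>k. F (B k)) = F (\<Union>k. B k)"
      unfolding F_def by (subst suminf_sum) (auto intro!: sum.cong)
  qed
  then have em: "emeasure \<mu> B = F B" if "B \<in> sets borel" for B
    unfolding \<mu>_def using that sets.sigma_algebra_axioms[of "borel :: 'm measure"]
    by (intro emeasure_measure_of_sigma) (auto simp: positive_def F_def)
  have "is_volume g \<mu>"
    unfolding is_volume_def
  proof (intro conjI ballI impI)
    show "sets \<mu> = sets borel"
      using sets.sigma_sets_eq[of "borel :: 'm measure"] sets.space_closed[of "borel :: 'm measure"]
      by (simp add: \<mu>_def)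
    fix d and B :: "'m set" assume d: "d \<in> A" and B: "B \<in> sets borel" "B \<subseteq> chart_dom d"
    \<comment> \<open>The change of chart goes from \<open>d\<close> to \<open>c i\<close>, as the
      compact set has to lie in the target chart.\<close>
    have eq: "emeasure (chart_measure g (c i)) (chart_map (c i) ` (B \<inter> D i)) =
        emeasure (chart_measure g d) (chart_map d ` (B \<inter> D i))" if i: "i < m" for i
    proof -
      have BD: "B \<inter> D i \<in> sets borel" "B \<inter> D i \<subseteq> chart_dom d" "B \<inter> D i \<subseteq> chart_dom (c i)"
        "chart_map (c i) ` (B \<inter> D i) \<subseteq> K i"
        using B part(4,5,6)[OF i] by auto
      show ?thesis
        using BD part(1)[OF i] d g
          volume_chart_change[OF g d part(1)[OF i] BD(1-3) part(2)[OF i] BD(4) part(3)[OF i]]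
        by (subst (1 2) emeasure_chart_measure) (auto intro: chart_image_borel)
    qed
    have "emeasure \<mu> B = (\<Sum>i<m. emeasure (chart_measure g d) (chart_map d ` (B \<inter> D i)))"
      by (simp add: em[OF B(1)] F_def eq)
    also have "\<dots> = emeasure (chart_measure g d) (\<Union>i<m. chart_map d ` (B \<inter> D i))"
    proof (rule sum_emeasure)
      show "(\<lambda>i. chart_map d ` (B \<inter> D i)) ` {..<m} \<subseteq> sets (chart_measure g d)"
        using B part(4) d by (auto intro!: chart_image_borel)
      show "disjoint_family_on (\<lambda>i. chart_map d ` (B \<inter> D i)) {..<m}"
        unfolding disjoint_family_on_def
      proof (intro ballI impI)
        fix i j assume "i \<in> {..<m}" "j \<in> {..<m}" "i \<noteq> j"
        then have "(B \<inter> D i) \<inter> (B \<inter> D j) = {}"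
          using part(7) unfolding disjoint_family_on_def by blast
        moreover have "inj_on (chart_map d) B"
          using inj_on_chart_map[OF d] B(2) by (rule inj_on_subset)
        ultimately show "chart_map d ` (B \<inter> D i) \<inter> chart_map d ` (B \<inter> D j) = {}"
          by (subst inj_on_image_Int[symmetric, where C = B]) auto
      qed
    qed simp
    also have "(\<Union>i<m. chart_map d ` (B \<inter> D i)) = chart_map d ` B"
      using part(8) by blast
    also have "emeasure (chart_measure g d) (chart_map d ` B) =
        (\<integral>\<^sup>+x\<in>chart_map d ` B. ennreal (volume_density g d x) \<partial>lborel)"
      using B by (intro emeasure_chart_measure g d chart_image_borel) auto
    finally show "emeasure \<mu> B = (\<integral>\<^sup>+x\<in>chart_map d ` B. ennreal (volume_density g d x) \<partial>lborel)" .
  qed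
  then show ?thesis
    by blast
qed

section \<open>The total volume\<close>

lemma is_volume_riem_volume:
  assumes "g \<in> riem_metrics A"
  shows "is_volume g (riem_volume A g)"
proof -
  have "riem_volume A g = (THE \<mu>. is_volume g \<mu>)"
    unfolding riem_volume_def is_volume_def volume_density_def ..
  then show ?thesis
    using theI'[of "is_volume g"] is_volume_exists[OF assms] is_volume_unique by metis
qed

lemma space_riem_volume: "g \<in> riem_metrics A \<Longrightarrow> space (riem_volume A g) = UNIV"
  using is_volume_riem_volume sets_eq_imp_space_eq[of "riem_volume A g" borel]
  unfolding is_volume_def by simp

text \<open>The charts and pieces are chosen before the metric, so one formula serves all metrics
  and can be differentiated in \<open>g\<close>. Stating it for \<open>emeasure\<close> also yields
  finiteness.\<close>

lemma total_volume_sum: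
  obtains m :: nat and c :: "nat \<Rightarrow> ('m, 'n) chart" and K S :: "nat \<Rightarrow> (real^'n) set"
  where "\<And>i. i < m \<Longrightarrow> c i \<in> A" "\<And>i. i < m \<Longrightarrow> compact (K i)"
    "\<And>i. i < m \<Longrightarrow> K i \<subseteq> chart_map (c i) ` chart_dom (c i)"
    "\<And>i. i < m \<Longrightarrow> S i \<subseteq> K i" "\<And>i. i < m \<Longrightarrow> S i \<in> sets borel"
    "\<And>g. g \<in> riem_metrics A \<Longrightarrow> emeasure (riem_volume A g) UNIV =
      ennreal (\<Sum>i<m. \<integral>x. indicator (S i) x * volume_density g (c i) x \<partial>lborel)"
proof -
  obtain m :: nat and c K D where part: "\<And>i. i < m \<Longrightarrow> c i \<in> A" "\<And>i. i < m \<Longrightarrow> compact (K i)"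
    "\<And>i. i < m \<Longrightarrow> K i \<subseteq> chart_map (c i) ` chart_dom (c i)" "\<And>i. i < m \<Longrightarrow> D i \<in> sets borel"
    "\<And>i. i < m \<Longrightarrow> D i \<subseteq> chart_dom (c i)" "\<And>i. i < m \<Longrightarrow> chart_map (c i) ` D i \<subseteq> K i"
    "disjoint_family_on D {..<m}" "(\<Union>i<m. D i) = UNIV"
    by (rule finite_borel_partition) blast
  let ?S = "\<lambda>i. chart_map (c i) ` D i"
  have Sm: "?S i \<in> sets borel" if "i < m" for i
    using part(1,4,5)[OF that] by (rule chart_image_borel)
  have "emeasure (riem_volume A g) UNIV =
      ennreal (\<Sum>i<m. \<integral>x. indicator (?S i) x * volume_density g (c i) x \<partial>lborel)"
    if g: "g \<in> riem_metrics A" for g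
  proof -
    note vol = is_volume_riem_volume[OF g, unfolded is_volume_def]
    have nonneg: "0 \<le> indicator (?S i) x * volume_density g (c i) x" if "i < m" for i x
    proof (cases "x \<in> ?S i")
      case True
      then have "x \<in> chart_map (c i) ` chart_dom (c i)"
        using part(3,6)[OF that] by blast
      then show ?thesis
        using volume_density_pos[OF g part(1)[OF that]] by (simp add: less_imp_le)
    qed simp
    have "emeasure (riem_volume A g) UNIV = (\<Sum>i<m. emeasure (riem_volume A g) (UNIV \<inter> D i))"
      using vol part by (intro sum_emeasure_cover) auto
    also have "\<dots> = (\<Sum>i<m. ennreal (\<integral>x. indicator (?S i) x * volume_density g (c i) x \<partial>lborel))"
    proof (rule sum.cong[OF refl])
      fix i assume "i \<in> {..<m}"
      then have i: "i < m" by simp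
      have "emeasure (riem_volume A g) (UNIV \<inter> D i) =
          (\<integral>\<^sup>+x\<in>?S i. ennreal (volume_density g (c i) x) \<partial>lborel)"
        using vol part(1,4,5)[OF i] by simp
      also have "\<dots> = (\<integral>\<^sup>+x. ennreal (indicator (?S i) x * volume_density g (c i) x) \<partial>lborel)"
        by (intro nn_integral_cong) (auto simp: indicator_def)
      also have "\<dots> = ennreal (\<integral>x. indicator (?S i) x * volume_density g (c i) x \<partial>lborel)"
      proof (rule nn_integral_eq_integral)
        show "integrable lborel (\<lambda>x. indicator (?S i) x * volume_density g (c i) x)"
          using continuous_on_volume_density[OF riem_metric_sym[OF g] part(1)[OF i]]
          by (intro integrable_indicator_compact[OF part(2)[OF i] _ part(6)[OF i] Sm[OF i]])
            (rule continuous_on_subset[OF _ part(3)[OF i]])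
      qed (use nonneg i in simp)
      finally show "emeasure (riem_volume A g) (UNIV \<inter> D i) =
          ennreal (\<integral>x. indicator (?S i) x * volume_density g (c i) x \<partial>lborel)" .
    qed
    also have "\<dots> = ennreal (\<Sum>i<m. \<integral>x. indicator (?S i) x * volume_density g (c i) x \<partial>lborel)"
      using nonneg by (intro sum_ennreal) (auto intro!: integral_nonneg_AE)
    finally show ?thesis .
  qed
  with part Sm show ?thesis
    by (intro that[of m c K ?S]) auto
qed

text \<open>A nonempty chart image is open, hence not negligible, and the density is positive on it.
  Finiteness matters too, because \<open>measure\<close> turns an infinite value into 0.\<close>

lemma total_volume_pos:
  assumes g: "g \<in> riem_metrics A"
  shows "0 < total_volume A g"
proof -
  obtain c where c: "c \<in> A" "chart_dom c \<noteq> {}"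
    using chart_cover by blast
  let ?U = "chart_map c ` chart_dom c"
  note vol = is_volume_riem_volume[OF g, unfolded is_volume_def]
  have dom: "chart_dom c \<in> sets borel"
    using open_chart_dom[OF c(1)] by simp
  have "emeasure (riem_volume A g) (chart_dom c) \<noteq> 0"
  proof
    assume "emeasure (riem_volume A g) (chart_dom c) = 0"
    then have "(\<integral>\<^sup>+x\<in>?U. ennreal (volume_density g c x) \<partial>lborel) = 0"
      using vol c(1) dom by simp
    then have "(\<integral>\<^sup>+x. ennreal (indicator ?U x *\<^sub>R volume_density g c x) \<partial>lborel) = 0"
      by (subst (asm) nn_integral_cong[where v = "\<lambda>x. ennreal (indicator ?U x *\<^sub>R volume_density g c x)"])
        (auto simp: indicator_def)
    moreover have "(\<lambda>x. indicator ?U x *\<^sub>R volume_density g c x) \<in> borel_measurable borel"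
      using c(1) g by (intro borel_measurable_continuous_on_indicator continuous_on_volume_density
          borel_open open_chart_image riem_metric_sym)
    ultimately have "AE x in lborel. ennreal (indicator ?U x *\<^sub>R volume_density g c x) = 0"
      by (subst (asm) nn_integral_0_iff_AE) auto
    then have "AE x in lborel. x \<notin> ?U"
      by eventually_elim (use volume_density_pos[OF g c(1)] in \<open>force simp: indicator_def ennreal_eq_0_iff\<close>)
    then have "?U \<in> null_sets lborel"
      using borel_open[OF open_chart_image[OF c(1)]] by (subst AE_iff_null_sets) auto
    then have "negligible ?U"
      using negligible_iff_null_sets null_sets_completionI by blast
    then show False
      using open_not_negligible[OF open_chart_image[OF c(1)]] c(2) by simp
  qed
  moreover have "emeasure (riem_volume A g) (chart_dom c) \<le> emeasure (riem_volume A g) UNIV"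
    using vol by (intro emeasure_mono) auto
  ultimately have "0 < emeasure (riem_volume A g) UNIV"
    by (metis le_zero_eq not_gr_zero)
  moreover have "emeasure (riem_volume A g) UNIV \<noteq> \<infinity>"
    using g by (rule_tac total_volume_sum) simp
  ultimately show ?thesis
    unfolding total_volume_def measure_def by (simp add: enn2real_positive_iff less_top)
qed

text \<open>For small t the line stays among the metrics, and the same pieces compute the volume of
  each of its points.\<close>

lemma total_volume_differentiable:
  assumes g: "g \<in> riem_metrics A" and h: "h \<in> sym_tensors A"
  shows "\<exists>l. ((\<lambda>t. total_volume A (g + t *\<^sub>R h)) has_field_derivative l) (at 0)"
proof -
  obtain m :: nat and c K S where part: "\<And>i. i < m \<Longrightarrow> c i \<in> A" "\<And>i. i < m \<Longrightarrow> compact (K i)"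
    "\<And>i. i < m \<Longrightarrow> K i \<subseteq> chart_map (c i) ` chart_dom (c i)"
    "\<And>i. i < m \<Longrightarrow> S i \<subseteq> K i" "\<And>i. i < m \<Longrightarrow> S i \<in> sets borel"
    "\<And>g. g \<in> riem_metrics A \<Longrightarrow> emeasure (riem_volume A g) UNIV =
      ennreal (\<Sum>i<m. \<integral>x. indicator (S i) x * volume_density g (c i) x \<partial>lborel)"
    by (rule total_volume_sum) blast
  obtain e where e: "0 < e" "\<And>t. \<bar>t\<bar> \<le> e \<Longrightarrow> g + t *\<^sub>R h \<in> riem_metrics A"
    using riem_metrics_open_line[OF g h] by blast
  define V where "V = (\<lambda>i t. \<integral>x. indicator (S i) x *
    sqrt (det (g (c i) (chart_inv (c i) x) + t *\<^sub>R h (c i) (chart_inv (c i) x))) \<partial>lborel)"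
  have V: "total_volume A (g + t *\<^sub>R h) = (\<Sum>i<m. V i t)" if t: "\<bar>t\<bar> \<le> e" for t
  proof -
    have pos: "0 \<le> indicator (S i) x * volume_density (g + t *\<^sub>R h) (c i) x" if "i < m" for i x
    proof (cases "x \<in> S i")
      case True
      then have "x \<in> chart_map (c i) ` chart_dom (c i)"
        using part(3,4)[OF that] by blast
      then show ?thesis
        using volume_density_pos[OF e(2)[OF t] part(1)[OF that]] by (simp add: less_imp_le)
    qed simp
    have "total_volume A (g + t *\<^sub>R h) =
        (\<Sum>i<m. \<integral>x. indicator (S i) x * volume_density (g + t *\<^sub>R h) (c i) x \<partial>lborel)"
      unfolding total_volume_def measure_def part(6)[OF e(2)[OF t]]
      using pos by (intro enn2real_ennreal sum_nonneg integral_nonneg_AE) auto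
    then show ?thesis
      by (simp add: V_def volume_density_def tensor_scaleR_apply)
  qed
  have "\<exists>l. (V i has_field_derivative l) (at 0)" if i: "i < m" for i
    unfolding V_def
  proof (rule differentiable_integral_sqrt_det[OF part(2)[OF i] part(4)[OF i] part(5)[OF i] _ _ e(1)])
    show "continuous_on (K i) (\<lambda>x. g (c i) (chart_inv (c i) x))"
      "continuous_on (K i) (\<lambda>x. h (c i) (chart_inv (c i) x))"
      by (rule continuous_on_subset[OF sym_tensor_continuous[OF riem_metric_sym[OF g] part(1)[OF i]] part(3)[OF i]],
          rule continuous_on_subset[OF sym_tensor_continuous[OF h part(1)[OF i]] part(3)[OF i]])
    show "0 < det (g (c i) (chart_inv (c i) x) + t *\<^sub>R h (c i) (chart_inv (c i) x))"
      if "\<bar>t\<bar> \<le> e" "x \<in> K i" for t x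
    proof -
      have "chart_inv (c i) x \<in> chart_dom (c i)"
        by (rule inv_into_into[OF subsetD[OF part(3)[OF i] that(2)]])
      from riem_metric_det_pos[OF e(2)[OF that(1)] part(1)[OF i] this] show ?thesis
        by (simp add: tensor_scaleR_apply)
    qed
  qed
  then obtain l where l: "\<And>i. i < m \<Longrightarrow> (V i has_field_derivative l i) (at 0)"
    by metis
  have "((\<lambda>t. \<Sum>i<m. V i t) has_field_derivative (\<Sum>i<m. l i)) (at 0)"
    using l by (intro DERIV_sum) auto
  then have "((\<lambda>t. total_volume A (g + t *\<^sub>R h)) has_field_derivative (\<Sum>i<m. l i)) (at 0)"
    by (rule has_field_derivative_transform_within_open[where S = "{-e<..<e}"]) (use e(1) V in auto)
  then show ?thesis ..
qed

end

section \<open>Affine vector fields on the space of metrics\<close>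

lemma iter_deriv_zero: "iter_deriv vs (\<lambda>x. 0) = (\<lambda>x. 0)"
  by (induction vs) auto

lemma smooth_on_zero: "smooth_on S (\<lambda>x. 0)"
  by (simp add: smooth_on_def iter_deriv_zero)

lemma zero_sym_tensor: "0 \<in> sym_tensors A"
  by (auto simp: sym_tensors_def smooth_on_zero transpose_def vec_eq_iff matrix_matrix_mult_def)

lemma matrix_inv_left:
  fixes G :: "real^'n::finite^'n"
  assumes "det G \<noteq> 0"
  shows "matrix_inv G ** G = mat 1"
proof -
  have "\<exists>B. G ** B = mat 1 \<and> B ** G = mat 1"
    using assms invertible_det_nz[of G] by (simp add: invertible_def)
  from someI_ex[OF this] show ?thesis
    by (simp add: matrix_inv_def)
qed

lemma diff_quot_real: "diff_quot F g h = (\<lambda>t. (F (g + t *\<^sub>R h) - F g) / t)"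
  for F :: "'a::real_vector \<Rightarrow> real"
  by (auto simp: diff_quot_def fun_eq_iff)

text \<open>A genuine derivative along the line is what gives the definite description its
  value.\<close>

lemma dir_deriv_real:
  assumes "((\<lambda>t. F (g + t *\<^sub>R h)) has_field_derivative d) (at 0)"
  shows "dir_deriv euclideanreal F g h = d"
proof -
  have lim: "(diff_quot F g h \<longlongrightarrow> d) (at 0)"
    using assms by (simp add: has_field_derivative_iff diff_quot_real)
  then show ?thesis
    unfolding dir_deriv_def limitin_canonical_iff
    by (intro the_equality) (auto intro: tendsto_unique[OF at_neq_bot])
qed

section \<open>Limits and smooth fields in the tensor topology\<close>

context closed_manifold
begin

lemma topspace_tensor_topology: "topspace (tensor_topology A) = sym_tensors A"
proof -
  obtain c where c: "c \<in> A"
    using chart_cover by blast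
  have "h \<in> topspace (tensor_topology A)" if h: "h \<in> sym_tensors A" for h
  proof -
    \<comment> \<open>Over the empty compact set the norm condition is vacuous.\<close>
    have "h \<in> tensor_ball A c {} [] 1 h"
      using h by (simp add: tensor_ball_def)
    moreover have "tensor_ball A c {} [] 1 h \<in> {tensor_ball A c K vs e h | c K vs e h.
        c \<in> A \<and> compact K \<and> K \<subseteq> chart_map c ` chart_dom c \<and> 0 < e \<and> h \<in> sym_tensors A}"
      unfolding mem_Collect_eq
      by (rule exI[of _ c], rule exI[of _ "{}"], rule exI[of _ "[]"], rule exI[of _ 1], rule exI[of _ h])
        (use c h in simp)
    ultimately show ?thesis
      unfolding tensor_topology_def topology_generated_by_topspace by (rule UnionI[rotated])
  qed
  then show ?thesis
    unfolding tensor_topology_def topology_generated_by_topspace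
    by (auto simp: tensor_ball_def)
qed

text \<open>Evaluation at a point separates tensor fields, and it is controlled by the seminorm of
  order zero over a singleton.\<close>

lemma tensor_limit_unique:
  fixes l :: "('m, 'n) tensor2"
  assumes l: "limitin (tensor_topology A) F l (at (0::real))"
    and l': "limitin (tensor_topology A) F l' (at 0)"
  shows "l = l'"
proof (rule ccontr)
  assume "l \<noteq> l'"
  have "\<exists>c p. l c p \<noteq> l' c p"
  proof (rule ccontr)
    assume "\<nexists>c p. l c p \<noteq> l' c p"
    then have "l c p = l' c p" for c p
      by blast
    then have "l = l'"
      by (intro ext)
    with \<open>l \<noteq> l'\<close> show False ..
  qed
  then obtain c p where cp: "l c p \<noteq> l' c p"
    by (elim exE)
  have sym: "l \<in> sym_tensors A" "l' \<in> sym_tensors A"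
    using limitin_topspace[OF l] limitin_topspace[OF l'] by (simp_all add: topspace_tensor_topology)
  \<comment> \<open>Both fields vanish off the chart domains by normalisation, so they can differ
    only at a genuine chart point.\<close>
  then have c: "c \<in> A" "p \<in> chart_dom c"
  proof -
    have "\<not> (c \<notin> A \<or> p \<notin> chart_dom c)"
    proof
      assume none: "c \<notin> A \<or> p \<notin> chart_dom c"
      show False
        using cp by (simp only: sym_tensor_vanishes[OF sym(1) none] sym_tensor_vanishes[OF sym(2) none])
    qed
    then show "c \<in> A" "p \<in> chart_dom c"
      by simp_all
  qed
  define e where "e = norm (l c p - l' c p) / 2"
  have e: "0 < e"
    using cp by (simp add: e_def)
  have ev: "eventually (\<lambda>t. norm (F t c p - k c p) < e) (at 0)"
    if k: "limitin (tensor_topology A) F k (at 0)" "k \<in> sym_tensors A" for k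
  proof -
    let ?B = "tensor_ball A c {chart_map c p} [] e k"
    have "openin (tensor_topology A) ?B"
      unfolding tensor_topology_def
      by (rule topology_generated_by_Basis, unfold mem_Collect_eq)
        (rule exI[of _ c], rule exI[of _ "{chart_map c p}"], rule exI[of _ "[]"], rule exI[of _ e],
          rule exI[of _ k], use c e k(2) in simp)
    moreover have "k \<in> ?B"
      using k(2) e by (simp add: tensor_ball_def)
    ultimately have "eventually (\<lambda>t. F t \<in> ?B) (at 0)"
      by (rule limitinD[OF k(1)])
    then show ?thesis
      by eventually_elim (simp add: tensor_ball_def chart_inv_map[OF c])
  qed
  have "eventually (\<lambda>t. norm (F t c p - l c p) < e \<and> norm (F t c p - l' c p) < e) (at 0)"
    using ev[OF l sym(1)] ev[OF l' sym(2)] by (rule eventually_conj)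
  then obtain t where t: "norm (F t c p - l c p) < e" "norm (F t c p - l' c p) < e"
    using eventually_happens[of _ "at (0::real)"] by auto
  have "norm (l c p - l' c p) \<le> norm (F t c p - l c p) + norm (F t c p - l' c p)"
    using norm_triangle_ineq4[of "F t c p - l' c p" "F t c p - l c p"] by simp
  then show False
    using t by (simp add: e_def)
qed

text \<open>For affine fields the difference quotients are exactly constant near 0, so no seminorm
  has to be estimated.\<close>

lemma dir_deriv_tensor_eventually:
  assumes ev: "eventually (\<lambda>t. diff_quot F g h t = l) (at 0)" and l: "l \<in> sym_tensors A"
  shows "limitin (tensor_topology A) (diff_quot F g h) l (at 0)"
    and "dir_deriv (tensor_topology A) F g h = l"
proof -
  show lim: "limitin (tensor_topology A) (diff_quot F g h) l (at 0)"
    unfolding limitin_def using l topspace_tensor_topology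
    by (auto intro: eventually_mono[OF ev])
  show "dir_deriv (tensor_topology A) F g h = l"
    unfolding dir_deriv_def using lim tensor_limit_unique by (intro the_equality)
qed

lemma eventually_riem_metric:
  assumes "g \<in> riem_metrics A" "h \<in> sym_tensors A"
  shows "eventually (\<lambda>t. g + t *\<^sub>R h \<in> riem_metrics A) (at (0::real))"
proof -
  obtain e where e: "0 < e" "\<And>t. \<bar>t\<bar> \<le> e \<Longrightarrow> g + t *\<^sub>R h \<in> riem_metrics A"
    using riem_metrics_open_line[OF assms] by blast
  then show ?thesis
    unfolding eventually_at by (intro exI[of _ e]) (auto simp: dist_real_def)
qed

text \<open>Excluding sums \<open>g + k\<close> avoids the continuity of addition in the tensor topology.\<close>

lemma affine_field_smooth:
  fixes k :: "('m, 'n) tensor2" and a :: real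
  assumes k: "k \<in> sym_tensors A" and ak: "a = 0 \<or> a = 1 \<and> k = 0"
  shows "(\<lambda>g. if g \<in> riem_metrics A then a *\<^sub>R g + k else 0) \<in> vector_fields A"
proof -
  let ?T = "tensor_topology A" and ?M = "riem_metrics A"
  let ?F = "\<lambda>g. if g \<in> ?M then a *\<^sub>R g + k else 0"
  \<comment> \<open>The closed form of the derivatives of an affine map: the map itself, then its
    linear part, then zero.\<close>
  define D :: "nat \<Rightarrow> ('m, 'n) tensor2 \<Rightarrow> (nat \<Rightarrow> ('m, 'n) tensor2) \<Rightarrow> ('m, 'n) tensor2"
    where "D = (\<lambda>n g H. if n = 0 then a *\<^sub>R g + k else if n = 1 then a *\<^sub>R H 0 else 0)"
  have D_sym: "D (Suc n) g H \<in> sym_tensors A" if "\<forall>i\<le>n. H i \<in> sym_tensors A" for n g H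
    using that sym_tensors_lincomb[OF _ zero_sym_tensor, of "H 0" a 0] by (simp add: D_def zero_sym_tensor)
  have step: "eventually (\<lambda>t. diff_quot (\<lambda>g'. nth_deriv ?T ?F n g' H) g (H n) t = D (Suc n) g H) (at 0)"
    if IH: "\<And>g'. g' \<in> ?M \<Longrightarrow> nth_deriv ?T ?F n g' H = D n g' H"
      and g: "g \<in> ?M" and H: "H n \<in> sym_tensors A" for n :: nat and g H
    using eventually_riem_metric[OF g H] eventually_neq_at_within[of 0]
  proof eventually_elim
    case (elim t)
    then have "diff_quot (\<lambda>g'. nth_deriv ?T ?F n g' H) g (H n) t = (1 / t) *\<^sub>R (D n (g + t *\<^sub>R H n) H - D n g H)"
      using IH g by (simp add: diff_quot_def del: nth_deriv.simps)
    also have "\<dots> = D (Suc n) g H"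
      using elim by (simp add: D_def scaleR_add_right)
    finally show ?case .
  qed
  have nth: "nth_deriv ?T ?F n g H = D n g H" if "g \<in> ?M" "\<forall>i<n. H i \<in> sym_tensors A" for n g H
    using that
  proof (induction n arbitrary: g)
    case 0
    then show ?case by (simp add: D_def)
  next
    case (Suc n)
    have "eventually (\<lambda>t. diff_quot (\<lambda>g'. nth_deriv ?T ?F n g' H) g (H n) t = D (Suc n) g H) (at 0)"
      using Suc by (intro step) auto
    then have "dir_deriv ?T (\<lambda>g'. nth_deriv ?T ?F n g' H) g (H n) = D (Suc n) g H"
      using Suc.prems by (intro dir_deriv_tensor_eventually(2) D_sym) auto
    then show ?case
      by simp
  qed
  have "frechet_smooth A ?T ?F"
    unfolding frechet_smooth_def
  proof (intro allI conjI ballI impI)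
    fix n :: nat and g H assume g: "g \<in> ?M" and H: "\<forall>i\<le>n. H i \<in> sym_tensors A"
    have "eventually (\<lambda>t. diff_quot (\<lambda>g'. nth_deriv ?T ?F n g' H) g (H n) t = D (Suc n) g H) (at 0)"
      using g H by (intro step nth) auto
    then show "\<exists>l. limitin ?T (diff_quot (\<lambda>g'. nth_deriv ?T ?F n g' H) g (H n)) l (at 0)"
      using dir_deriv_tensor_eventually(1) D_sym[OF H] by blast
  next
    fix n :: nat
    let ?P = "prod_topology (subtopology ?T ?M) (product_topology (\<lambda>_. ?T) {..<n})"
    have top: "topspace ?P = (sym_tensors A \<inter> ?M) \<times> PiE {..<n} (\<lambda>_. sym_tensors A)"
      by (simp add: topspace_tensor_topology)
    have const: "continuous_map ?P ?T (\<lambda>_. h)" if "h \<in> sym_tensors A" for h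
      using that by (simp add: topspace_tensor_topology)
    have "continuous_map ?P ?T (\<lambda>z. D n (fst z) (snd z))"
    proof -
      \<comment> \<open>By \<open>ak\<close> each case is a constant map or a projection: to the
        base point for \<open>n = 0\<close>, \<open>a = 1\<close>, and to the direction
        \<open>H 0\<close> for \<open>n = 1\<close>, \<open>a = 1\<close>.\<close>
      consider "n = 0" "a = 0" | "n = 0" "a = 1" "k = 0" | "n = 1" "a = 0" | "n = 1" "a = 1" | "n \<ge> 2"
        using ak by (cases "n = 0"; cases "n = 1") auto
      then show ?thesis
      proof cases
        case 1
        then show ?thesis
          using const[OF k] by (simp add: D_def)
      next
        case 2
        have "continuous_map ?P ?T fst"
          by (intro continuous_map_into_fulltopology[OF continuous_map_fst])
        then show ?thesis
          using 2 by (simp add: D_def)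
      next
        case 3
        then show ?thesis
          using const[OF zero_sym_tensor] by (simp add: D_def)
      next
        case 4
        have "continuous_map ?P ?T ((\<lambda>H. H 0) \<circ> snd)"
          using 4 by (intro continuous_map_compose[OF continuous_map_snd] continuous_map_product_projection) auto
        then show ?thesis
          using 4 by (simp add: D_def o_def)
      next
        case 5
        then show ?thesis
          using const[OF zero_sym_tensor] by (simp add: D_def)
      qed
    qed
    then show "continuous_map ?P ?T (\<lambda>(g, H). nth_deriv ?T ?F n g H)"
    proof (rule continuous_map_eq)
      fix z assume z: "z \<in> topspace ?P"
      have "fst z \<in> ?M" "\<forall>i<n. snd z i \<in> sym_tensors A"
        using z[unfolded top] by (simp_all add: mem_Times_iff PiE_iff)
      from nth[OF this] show "D n (fst z) (snd z) = (case z of (g, H) \<Rightarrow> nth_deriv ?T ?F n g H)"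
        by (simp only: case_prod_beta)
    qed
  qed
  then show ?thesis
    by (simp add: vector_fields_def)
qed

lemma tautological_vector_field: "tautological_field A \<in> vector_fields A"
  using affine_field_smooth[OF zero_sym_tensor, of 1] by (simp add: tautological_field_def cong: if_cong)

lemma constant_vector_field:
  "h \<in> sym_tensors A \<Longrightarrow> (\<lambda>g. if g \<in> riem_metrics A then h else 0) \<in> vector_fields A"
  using affine_field_smooth[of h 0] by (simp cong: if_cong)

section \<open>The Ebin metric on the tautological field\<close>

lemma ebin_metric_self:
  assumes g: "g \<in> riem_metrics A"
  shows "ebin_metric A g g g = real CARD('n) * total_volume A g"
proof -
  have "(let c = chart_at A p in trace (matrix_inv (g c p) ** g c p ** matrix_inv (g c p) ** g c p)) = real CARD('n)" for p
  proof -
    have "det (g (chart_at A p) p) \<noteq> 0"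
      using riem_metric_det_pos[OF g chart_at(1) chart_at(2)[of p]] by simp
    then show ?thesis
      by (simp add: Let_def matrix_inv_left matrix_mul_assoc[symmetric] trace_I)
  qed
  then show ?thesis
    by (simp add: ebin_metric_def total_volume_def space_riem_volume[OF g])
qed

lemma ebin_metric_zero: "ebin_metric A g 0 k = 0" "ebin_metric A g h 0 = 0"
  by (simp_all add: ebin_metric_def Let_def trace_def matrix_matrix_mult_def)

end

section \<open>Constancy of the length of the parallel tautological field\<close>

theorem proposition3p1:
  fixes A :: "('m::t2_space, 'n::finite) chart set"
    and f :: "('m, 'n) tensor2 \<Rightarrow> real"
    and nabla :: "(('m, 'n) tensor2 \<Rightarrow> ('m, 'n) tensor2) \<Rightarrow>
      (('m, 'n) tensor2 \<Rightarrow> ('m, 'n) tensor2) \<Rightarrow> ('m, 'n) tensor2 \<Rightarrow> ('m, 'n) tensor2"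
  assumes "compact (UNIV :: 'm set)"
    and "smooth_atlas A"
    and "frechet_smooth A euclideanreal f"
    and "levi_civita A (conformal_ebin_metric A f) nabla"
    and "\<forall>Y\<in>vector_fields A. \<forall>g\<in>riem_metrics A. nabla Y (tautological_field A) g = 0"
  shows "\<exists>C. \<forall>g\<in>riem_metrics A. f g = - (1 / 2) * ln (total_volume A g) + C"
proof -
  interpret closed_manifold A
    by standard (use assms in auto)
  let ?M = "riem_metrics A" and ?X = "tautological_field A"
  define E where "E = (\<lambda>g. exp (2 * f g) * total_volume A g)"
  have deriv: "((\<lambda>t. E (g + t *\<^sub>R h)) has_field_derivative 0) (at 0)"
    if g: "g \<in> ?M" and h: "h \<in> sym_tensors A" for g h
  proof -
    \<comment> \<open>Order zero of \<open>frechet_smooth\<close> already contains the derivative of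
      \<open>f\<close> along lines.\<close>
    have "\<exists>l. limitin euclideanreal (diff_quot (\<lambda>g'. nth_deriv euclideanreal f 0 g' (\<lambda>_. h)) g h) l (at 0)"
      using spec[OF bspec[OF conjunct1[OF spec[OF assms(3)[unfolded frechet_smooth_def], of 0]] g], of "\<lambda>_. h"] h
      by simp
    then obtain df where "((\<lambda>t. (f (g + t *\<^sub>R h) - f g) / t) \<longlongrightarrow> df) (at 0)"
      by (auto simp: diff_quot_real)
    then have df: "((\<lambda>t. f (g + t *\<^sub>R h)) has_field_derivative df) (at 0)"
      by (simp add: has_field_derivative_iff)
    obtain dV where dV: "((\<lambda>t. total_volume A (g + t *\<^sub>R h)) has_field_derivative dV) (at 0)"
      using total_volume_differentiable[OF g h] by blast
    from DERIV_mult[OF DERIV_fun_exp[OF DERIV_cmult[OF df, of 2]] dV]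
    obtain d where d: "((\<lambda>t. E (g + t *\<^sub>R h)) has_field_derivative d) (at 0)"
      by (auto simp: E_def)
    \<comment> \<open>The constant field \<open>h\<close>, cut off outside the cone to meet the
      normalisation of vector fields.\<close>
    let ?Y = "\<lambda>g. if g \<in> ?M then h else 0"
    let ?Q = "\<lambda>g. conformal_ebin_metric A f g (?X g) (?X g)"
    have Q: "?Q g' = real CARD('n) * E g'" if "g' \<in> ?M" for g'
      using that by (simp add: conformal_ebin_metric_def tautological_field_def ebin_metric_self E_def)
    obtain e where e: "0 < e" "\<And>t. \<bar>t\<bar> \<le> e \<Longrightarrow> g + t *\<^sub>R h \<in> riem_metrics A"
      using riem_metrics_open_line[OF g h] by blast
    have "((\<lambda>t. real CARD('n) * E (g + t *\<^sub>R h)) has_field_derivative real CARD('n) * d) (at 0)"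
      using d by (rule DERIV_cmult)
    then have "((\<lambda>t. ?Q (g + t *\<^sub>R h)) has_field_derivative real CARD('n) * d) (at 0)"
      by (rule has_field_derivative_transform_within_open[where S = "{-e<..<e}"]) (use e Q in auto)
    then have "real CARD('n) * d = dir_deriv euclideanreal ?Q g (?Y g)"
      using dir_deriv_real[of ?Q g h] g by simp
    also have "\<dots> = conformal_ebin_metric A f g (nabla ?Y ?X g) (?X g) +
        conformal_ebin_metric A f g (?X g) (nabla ?Y ?X g)"
    proof -
      have "metric_compatible A (conformal_ebin_metric A f) nabla"
        using assms(4) by (simp add: levi_civita_def)
      note this[unfolded metric_compatible_def, THEN bspec, THEN bspec, THEN bspec, THEN bspec]
      from this[OF constant_vector_field[OF h] tautological_vector_field tautological_vector_field g]
      show ?thesis .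
    qed
    also have "nabla ?Y ?X g = 0"
      using assms(5) constant_vector_field[OF h] g by blast
    \<comment> \<open>The factor \<open>CARD('n)\<close> cancels because it is nonzero: types are
      inhabited.\<close>
    finally have "d = 0"
      unfolding conformal_ebin_metric_def ebin_metric_zero by simp
    with d show ?thesis
      by simp
  qed
  have const: "E g = E k" if g: "g \<in> ?M" and k: "k \<in> ?M" for g k
  proof -
    have h: "k - g \<in> sym_tensors A"
      using sym_tensors_lincomb[OF riem_metric_sym[OF k] riem_metric_sym[OF g], of 1 "-1"] by simp
    have "((\<lambda>t. E (g + t *\<^sub>R (k - g))) has_field_derivative 0) (at s within {0..1})" if s: "s \<in> {0..1}" for s
    proof -
      have eq: "(1 - s) *\<^sub>R g + s *\<^sub>R k = g + s *\<^sub>R (k - g)"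
        by (simp add: algebra_simps)
      have "g + s *\<^sub>R (k - g) \<in> ?M"
        unfolding eq[symmetric] using s
        by (intro riem_metrics_convex[OF g k] sym_tensors_lincomb riem_metric_sym g k) auto
      \<comment> \<open>\<open>deriv\<close> differentiates at parameter 0 from any base point;
        moving the base point along the segment gives the derivative at s.\<close>
      from deriv[OF this h]
      have "((\<lambda>t. E (g + (t + s) *\<^sub>R (k - g))) has_field_derivative 0) (at 0)"
        by (simp add: scaleR_add_left add_ac)
      then have "((\<lambda>t. E (g + t *\<^sub>R (k - g))) has_field_derivative 0) (at (0 + s))"
        by (subst DERIV_shift)
      then show ?thesis
        using has_field_derivative_at_within by fastforce
    qed
    then obtain c where "\<forall>t\<in>{0..1}. E (g + t *\<^sub>R (k - g)) = c"
      using has_field_derivative_zero_constant[of "{0..1::real}" "\<lambda>t. E (g + t *\<^sub>R (k - g))"] by auto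
    then have "E (g + 0 *\<^sub>R (k - g)) = c" "E (g + 1 *\<^sub>R (k - g)) = c"
      by (meson atLeastAtMost_iff order_refl zero_le_one)+
    then show ?thesis
      by simp
  qed
  show ?thesis
  proof (cases "?M = {}")
    case False
    then obtain g0 where g0: "g0 \<in> ?M"
      by blast
    \<comment> \<open>Any base metric \<open>g0\<close> fixes the constant, as \<open>E\<close>
      takes a single value on the cone.\<close>
    have "f g = - (1 / 2) * ln (total_volume A g) + ln (E g0) / 2" if g: "g \<in> ?M" for g
    proof -
      have "ln (E g) = 2 * f g + ln (total_volume A g)"
        using total_volume_pos[OF g] by (simp add: E_def ln_mult)
      then show ?thesis
        using const[OF g g0] by (simp add: field_simps)
    qed
    then show ?thesis
      by blast
  qed simp
qed

end
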